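(* If $(A,B)$ and $(A',B')$ are isomorphic C-algebras, then their sets of standard feasible multiplicities $\{\zeta_\chi : \chi\in\mathrm{Irr}(A)\}$ and $\{\zeta'_{\chi'} : \chi'\in\mathrm{Irr}(A')\}$ are the same, where $\zeta$ and $\zeta'$ are the standard feasible traces of $(A,B)$ and $(A',B')$, respectively.
   Context: A C-algebra (not necessarily commutative) is a pair $(A,B)$, where $A$ is a finite dimensional associative algebra over $\mathbb{C}$ with identity $1_A$ and $B$ is a linear basis of $A$, such that: (I) $1_A\in B$ and the structure constants $\lambda_{abc}$ defined by $ab=\sum_{c\in B}\lambda_{abc}c$ ($a,b\in B$) are real; (II) there is a semilinear involutory anti-automorphism $*$ of $A$ with $B^*=B$; (III) for $a,b\in B$, $\lambda_{ab1_A}=\delta_{ab^*}|a|$ with $|a|>0$; (IV) the map $b\mapsto |b|$, $b\in B$, is (extends linearly to) a one-dimensional $*$-linear representation of $A$, called the degree map. $A$ is then semisimple. $\mathrm{Irr}(A)$ is the set of irreducible characters of $A$, and $|B^+|=\sum_{b\in B}|b|$. A C-algebra homomorphism from $(A,B)$ to $(A',B')$ is a $*$-algebra homomorphism $f:A\to A'$ with $f(B)=B'$; it is an isomorphism if it is bijective. Two C-algebras are isomorphic if there is a C-algebra isomorphism between them. The standard feasible trace of a C-algebra $(A,B)$ is the linear function $\zeta:A\to\mathbb{C}$ with $\zeta(b)=\delta_{1_A b}|B^+|$ for $b\in B$. It can be written uniquely as $\zeta=\sum_{\chi\in\mathrm{Irr}(A)}\zeta_\chi\chi$ with nonzero $\zeta_\chi\in\mathbb{C}$;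 $\zeta_\chi$ is called the standard feasible multiplicity of $\chi$, and $\{\zeta_\chi:\chi\in\mathrm{Irr}(A)\}$ is the set of standard feasible multiplicities of $(A,B)$. *)

theory Defs
  imports
    "Jordan_Normal_Form.VS_Connect"
    "HOL-Library.FuncSet"
begin

text \<open>
  A finite-dimensional associative unital algebra over the complex numbers, together with a
  distinguished (finite) linear basis \<open>B\<close>.
\<close>

locale based_algebra = finite_dimensional_vector_space scale B
  for scale :: "complex \<Rightarrow> 'a::ring_1 \<Rightarrow> 'a" and B :: "'a set" +
  assumes scale_mult_left: "scale c x * y = scale c (x * y)"
    and scale_mult_right: "x * scale c y = scale c (x * y)"
begin

definition structure_constant :: "'a \<Rightarrow> 'a \<Rightarrow> 'a \<Rightarrow> complex" where
  "structure_constant a b c = representation B (a * b) c"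

definition is_representation :: "nat \<Rightarrow> ('a \<Rightarrow> complex mat) \<Rightarrow> bool" where
  "is_representation n \<rho> \<longleftrightarrow>
     (\<forall>x. \<rho> x \<in> carrier_mat n n) \<and>
     (\<forall>x y. \<rho> (x + y) = \<rho> x + \<rho> y) \<and>
     (\<forall>c x. \<rho> (scale c x) = c \<cdot>\<^sub>m \<rho> x) \<and>
     (\<forall>x y. \<rho> (x * y) = \<rho> x * \<rho> y) \<and>
     \<rho> 1 = 1\<^sub>m n"

definition is_irreducible_representation :: "nat \<Rightarrow> ('a \<Rightarrow> complex mat) \<Rightarrow> bool" where
  "is_irreducible_representation n \<rho> \<longleftrightarrow>
     is_representation n \<rho> \<and> n > 0 \<and>
     (\<forall>W. VectorSpace.subspace class_ring W (module_vec TYPE(complex) n) \<and>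
          (\<forall>x. \<forall>w\<in>W. \<rho> x *\<^sub>v w \<in> W) \<longrightarrow>
          W = {0\<^sub>v n} \<or> W = carrier_vec n)"

definition Irr :: "('a \<Rightarrow> complex) set" where
  "Irr = {\<chi>. \<exists>n \<rho>. is_irreducible_representation n \<rho> \<and>
                   (\<forall>x. \<chi> x = (\<Sum>i<n. \<rho> x $$ (i, i)))}"

end

locale based_star_algebra = based_algebra scale B
  for scale :: "complex \<Rightarrow> 'a::ring_1 \<Rightarrow> 'a" and B :: "'a set" +
  fixes star :: "'a \<Rightarrow> 'a"
  assumes star_add: "star (x + y) = star x + star y"
    and star_scale: "star (scale c x) = scale (cnj c) (star x)"
    and star_mult: "star (x * y) = star y * star x"
    and star_star: "star (star x) = x"
    and star_basis: "star ` B = B"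
begin

text \<open>
  The number \<open>|a|\<close> for \<open>a \<in> B\<close>, read off from the axiom
  \<open>\<lambda>\<^sub>a\<^sub>b\<^sub>1 = \<delta> |a|\<close> at \<open>b = a\<^sup>*\<close>; it is only meaningful on \<open>B\<close>. The degree map below is its
  linear extension to the whole algebra.
\<close>

definition basis_degree :: "'a \<Rightarrow> real" where
  "basis_degree a = Re (structure_constant a (star a) 1)"

definition degree_map :: "'a \<Rightarrow> complex" where
  "degree_map x = (\<Sum>b\<in>B. representation B x b * of_real (basis_degree b))"

definition total_degree :: real where
  "total_degree = (\<Sum>b\<in>B. basis_degree b)"

end

text \<open>
  The involution is a parameter, but the axioms determine it from the algebra and \<open>B\<close>: for
  \<open>a \<in> B\<close>, \<open>star a\<close> is the only \<open>b \<in> B\<close> with \<open>structure_constant a b 1 \<noteq> 0\<close>. A linear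
  \<open>degree_map\<close> is a one-dimensional \<open>*\<close>-representation exactly under the last three axioms.
\<close>

locale C_algebra = based_star_algebra scale B star
  for scale :: "complex \<Rightarrow> 'a::ring_1 \<Rightarrow> 'a" and B :: "'a set" and star :: "'a \<Rightarrow> 'a" +
  assumes one_in_basis: "1 \<in> B"
    and structure_constant_real:
      "\<lbrakk>a \<in> B; b \<in> B; c \<in> B\<rbrakk> \<Longrightarrow> structure_constant a b c \<in> \<real>"
    and structure_constant_one:
      "\<lbrakk>a \<in> B; b \<in> B\<rbrakk> \<Longrightarrow>
         structure_constant a b 1 = (if a = star b then of_real (basis_degree a) else 0)"
    and basis_degree_pos: "a \<in> B \<Longrightarrow> basis_degree a > 0"
    and degree_map_one: "degree_map 1 = 1"
    and degree_map_mult: "degree_map (x * y) = degree_map x * degree_map y"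
    and degree_map_star: "degree_map (star x) = cnj (degree_map x)"
begin

definition standard_feasible_trace :: "'a \<Rightarrow> complex" where
  "standard_feasible_trace x = (\<Sum>b\<in>B. representation B x b *
     (if b = 1 then of_real total_degree else 0))"

text \<open>
  The family \<open>(\<zeta>\<^sub>\<chi>)\<close> indexed by \<open>Irr\<close>. It exists because the algebra is semisimple; it is unique
  because the irreducible characters are linearly independent, and for the same reason \<open>Irr\<close>
  is finite, so that the sum is a genuine one. Values outside \<open>Irr\<close> are fixed to \<open>undefined\<close>.
\<close>

definition standard_feasible_multiplicity :: "('a \<Rightarrow> complex) \<Rightarrow> complex" where
  "standard_feasible_multiplicity =
     (THE m. m \<in> Irr \<rightarrow>\<^sub>E - {0} \<and>
             (\<forall>x. standard_feasible_trace x = (\<Sum>\<chi>\<in>Irr. m \<chi> * \<chi> x)))"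

definition standard_feasible_multiplicities :: "complex set" where
  "standard_feasible_multiplicities = standard_feasible_multiplicity ` Irr"

end

locale C_algebra_hom =
  source: C_algebra scale B star + target: C_algebra scale' B' star'
  for scale :: "complex \<Rightarrow> 'a::ring_1 \<Rightarrow> 'a" and B star
    and scale' :: "complex \<Rightarrow> 'b::ring_1 \<Rightarrow> 'b" and B' star' +
  fixes f :: "'a \<Rightarrow> 'b"
  assumes hom_add: "f (x + y) = f x + f y"
    and hom_scale: "f (scale c x) = scale' c (f x)"
    and hom_mult: "f (x * y) = f x * f y"
    and hom_one: "f 1 = 1"
    and hom_star: "f (star x) = star' (f x)"
    and hom_basis: "f ` B = B'"

definition C_algebra_isomorphic ::
  "(complex \<Rightarrow> 'a::ring_1 \<Rightarrow> 'a) \<Rightarrow> 'a set \<Rightarrow> ('a \<Rightarrow> 'a) \<Rightarrow>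
   (complex \<Rightarrow> 'b::ring_1 \<Rightarrow> 'b) \<Rightarrow> 'b set \<Rightarrow> ('b \<Rightarrow> 'b) \<Rightarrow> bool" where
  "C_algebra_isomorphic scale B star scale' B' star' \<longleftrightarrow>
     (\<exists>f. C_algebra_hom scale B star scale' B' star' f \<and> bij f)"

end

theory Submission
  imports Defs "Jordan_Normal_Form.Spectral_Radius"
begin

text \<open>
  An isomorphism carries irreducible characters and standard feasible traces to each other, so it
  carries any multiplicity family to a multiplicity family. Since the multiplicities are given by a
  definite description, the point is that such a family exists and is unique.

  The coefficient \<open>\<tau>\<close> of \<open>1\<close> is a faithful positive trace. Hence every two-sided ideal has an
  orthogonal complement and is generated by a central idempotent, and every trace functional is
  \<open>x \<mapsto> \<tau>(xz)\<close> with \<open>z\<close> central. By Schur's lemma an irreducible character is \<open>c \<tau>(xe)\<close> with \<open>c \<noteq> 0\<close>,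
  where \<open>1 - e\<close> generates the kernel of the representation. The idempotents \<open>e\<close> of different
  characters are orthogonal, and they sum to \<open>1\<close>, since otherwise a minimal left ideal in the
  remaining corner would give a further irreducible character. So \<open>\<tau>\<close> is the sum of the \<open>\<chi> / c\<close>, and
  evaluation at the \<open>e\<close> gives uniqueness.
\<close>

subsection \<open>Minimal left ideals and irreducible representations\<close>

text \<open>Unfolds the record-based notion of subspace once, so that irreducibility can be used
  through plain closure conditions on sets of vectors.\<close>

lemma subspace_carrier_vec_iff:
  fixes W :: "'a::field vec set"
  shows "VectorSpace.subspace class_ring W (module_vec TYPE('a) n) \<longleftrightarrow>
    W \<subseteq> carrier_vec n \<and> 0\<^sub>v n \<in> W \<and> (\<forall>v\<in>W. \<forall>w\<in>W. v + w \<in> W) \<and>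
    (\<forall>c. \<forall>v\<in>W. c \<cdot>\<^sub>v v \<in> W)"
  by (auto simp: VectorSpace.subspace_def submodule_def vec_vs vec_module module_vec_simps)

lemma index_mult_mat_unit_vec:
  fixes M :: "'a::semiring_1 mat"
  assumes "M \<in> carrier_mat m n" "i < m" "j < n"
  shows "(M *\<^sub>v unit_vec n j) $ i = M $$ (i, j)"
  using assms by (simp add: scalar_prod_right_unit)

lemma mat_eqI_mult_vec:
  fixes M :: "'a::semiring_1 mat"
  assumes M: "M \<in> carrier_mat m n" "N \<in> carrier_mat m n"
    and eq: "\<And>w. w \<in> carrier_vec n \<Longrightarrow> M *\<^sub>v w = N *\<^sub>v w"
  shows "M = N"
proof (rule eq_matI)
  fix i j assume "i < dim_row N" "j < dim_col N"
  then have "i < m" "j < n" using M by auto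
  then show "M $$ (i, j) = N $$ (i, j)"
    using index_mult_mat_unit_vec[OF M(1)] index_mult_mat_unit_vec[OF M(2)] eq[of "unit_vec n j"]
    by (metis unit_vec_carrier)
qed (use M in auto)

context based_algebra
begin

definition left_ideal :: "'a set \<Rightarrow> bool" where
  "left_ideal L \<longleftrightarrow> subspace L \<and> (\<forall>a. \<forall>x\<in>L. a * x \<in> L)"

definition minimal_left_ideal :: "'a set \<Rightarrow> bool" where
  "minimal_left_ideal L \<longleftrightarrow>
     left_ideal L \<and> L \<noteq> {0} \<and> (\<forall>K. left_ideal K \<and> K \<subseteq> L \<longrightarrow> K = {0} \<or> K = L)"

lemma left_idealI:
  assumes "0 \<in> L" "\<And>x y. x \<in> L \<Longrightarrow> y \<in> L \<Longrightarrow> x + y \<in> L"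
    "\<And>c x. x \<in> L \<Longrightarrow> scale c x \<in> L" "\<And>a x. x \<in> L \<Longrightarrow> a * x \<in> L"
  shows "left_ideal L"
  unfolding left_ideal_def subspace_def using assms by blast

lemma left_idealD:
  assumes "left_ideal L"
  shows "subspace L" "0 \<in> L" "x \<in> L \<Longrightarrow> y \<in> L \<Longrightarrow> x + y \<in> L" "x \<in> L \<Longrightarrow> scale c x \<in> L"
    "x \<in> L \<Longrightarrow> a * x \<in> L" "x \<in> L \<Longrightarrow> y \<in> L \<Longrightarrow> x - y \<in> L"
  using assms subspace_diff[of L x y] unfolding left_ideal_def subspace_def by blast+

text \<open>Take a nonzero left ideal inside \<open>K\<close> of least dimension: a nonzero left
  ideal contained in it has the same dimension and hence equals it.\<close>

lemma minimal_left_ideal_exists: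
  assumes "left_ideal K" "K \<noteq> {0}"
  shows "\<exists>L. minimal_left_ideal L \<and> L \<subseteq> K"
proof -
  let ?P = "\<lambda>L. left_ideal L \<and> L \<noteq> {0} \<and> L \<subseteq> K"
  obtain L where L: "?P L" and min: "\<And>M. ?P M \<Longrightarrow> dim L \<le> dim M"
    using ex_has_least_nat[of ?P K dim] assms by blast
  have "M = {0} \<or> M = L" if M: "left_ideal M" "M \<subseteq> L" for M
  proof (cases "M = {0}")
    case False
    then have "dim L \<le> dim M" using min[of M] L M by auto
    then show ?thesis
      using subspace_dim_equal[of M L] L M left_idealD(1) by blast
  qed simp
  then show ?thesis using L unfolding minimal_left_ideal_def by blast
qed

section \<open>Matrix representations, Schur's lemma, and the link with minimal left ideals\<close>

lemma is_representationD:
  assumes "is_representation n \<rho>"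
  shows "\<rho> x \<in> carrier_mat n n" "\<rho> (x + y) = \<rho> x + \<rho> y" "\<rho> (scale c x) = c \<cdot>\<^sub>m \<rho> x"
    "\<rho> (x * y) = \<rho> x * \<rho> y" "\<rho> 1 = 1\<^sub>m n" "dim_row (\<rho> x) = n" "dim_col (\<rho> x) = n"
  using assms unfolding is_representation_def carrier_mat_def mem_Collect_eq by blast+

lemma is_representation_zero:
  assumes "is_representation n \<rho>"
  shows "\<rho> 0 = 0\<^sub>m n n"
proof -
  have "\<rho> 0 = 0 \<cdot>\<^sub>m \<rho> 0" using is_representationD(3)[OF assms, of 0 0] by simp
  also have "\<dots> = 0\<^sub>m n n" by (rule eq_matI) (simp_all add: is_representationD(6,7)[OF assms])
  finally show ?thesis .
qed

lemma is_representation_diff: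
  assumes "is_representation n \<rho>"
  shows "\<rho> (x - y) = \<rho> x - \<rho> y"
proof -
  have x: "\<rho> x = \<rho> (x - y) + \<rho> y" using is_representationD(2)[OF assms, of "x - y" y] by simp
  show ?thesis by (subst x, rule eq_matI) (simp_all add: is_representationD(6,7)[OF assms])
qed

lemma is_irreducible_representationI:
  assumes "is_representation n \<rho>" "n > 0"
    and "\<And>W. \<lbrakk>W \<subseteq> carrier_vec n; 0\<^sub>v n \<in> W; \<And>v w. v \<in> W \<Longrightarrow> w \<in> W \<Longrightarrow> v + w \<in> W;
      \<And>c v. v \<in> W \<Longrightarrow> c \<cdot>\<^sub>v v \<in> W; \<And>x v. v \<in> W \<Longrightarrow> \<rho> x *\<^sub>v v \<in> W\<rbrakk>
      \<Longrightarrow> W = {0\<^sub>v n} \<or> W = carrier_vec n"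
  shows "is_irreducible_representation n \<rho>"
  unfolding is_irreducible_representation_def subspace_carrier_vec_iff
proof (intro conjI allI impI)
  show "is_representation n \<rho>" "n > 0" by fact+
  fix W assume "(W \<subseteq> carrier_vec n \<and> 0\<^sub>v n \<in> W \<and> (\<forall>v\<in>W. \<forall>w\<in>W. v + w \<in> W) \<and>
    (\<forall>c. \<forall>v\<in>W. c \<cdot>\<^sub>v v \<in> W)) \<and> (\<forall>x. \<forall>w\<in>W. \<rho> x *\<^sub>v w \<in> W)"
  then show "W = {0\<^sub>v n} \<or> W = carrier_vec n" by (elim conjE) (rule assms(3); simp)
qed

lemma is_irreducible_representationD:
  assumes "is_irreducible_representation n \<rho>"
  shows "is_representation n \<rho>" "n > 0"
    "\<lbrakk>W \<subseteq> carrier_vec n; 0\<^sub>v n \<in> W; \<And>v w. v \<in> W \<Longrightarrow> w \<in> W \<Longrightarrow> v + w \<in> W;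
      \<And>c v. v \<in> W \<Longrightarrow> c \<cdot>\<^sub>v v \<in> W; \<And>x v. v \<in> W \<Longrightarrow> \<rho> x *\<^sub>v v \<in> W\<rbrakk>
      \<Longrightarrow> W = {0\<^sub>v n} \<or> W = carrier_vec n"
  using assms unfolding is_irreducible_representation_def subspace_carrier_vec_iff by simp_all

text \<open>Since \<open>z\<close> is central, every eigenspace of \<open>\<rho> z\<close> is
  invariant. An eigenvalue exists over the complex numbers because \<open>n > 0\<close>, and by
  irreducibility its eigenspace is the whole space.\<close>

lemma schur:
  assumes irr: "is_irreducible_representation n \<rho>" and z: "\<And>x. z * x = x * z"
  shows "\<exists>c. \<rho> z = c \<cdot>\<^sub>m 1\<^sub>m n"
proof -
  note rep = is_irreducible_representationD(1)[OF irr]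
  note D = is_representationD[OF rep]
  obtain c where "c \<in> spectrum (\<rho> z)"
    using spectrum_non_empty[OF D(1) is_irreducible_representationD(2)[OF irr]] by blast
  then obtain v where v: "v \<in> carrier_vec n" "v \<noteq> 0\<^sub>v n" "\<rho> z *\<^sub>v v = c \<cdot>\<^sub>v v"
    unfolding spectrum_def eigenvalue_def eigenvector_def by (auto simp: D(6,7))
  define W where "W = {w \<in> carrier_vec n. \<rho> z *\<^sub>v w = c \<cdot>\<^sub>v w}"
  have "W = {0\<^sub>v n} \<or> W = carrier_vec n"
  proof (rule is_irreducible_representationD(3)[OF irr])
    show "W \<subseteq> carrier_vec n" by (auto simp: W_def)
    show "0\<^sub>v n \<in> W" using D(1)[of z] by (auto simp: W_def)
    show "v + w \<in> W" if "v \<in> W" "w \<in> W" for v w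
      using that by (simp add: W_def mult_add_distrib_mat_vec[OF D(1)] smult_add_distrib_vec[of _ n])
    show "k \<cdot>\<^sub>v w \<in> W" if "w \<in> W" for k w
      using that by (simp add: W_def mult_mat_vec[OF D(1)] smult_smult_assoc mult.commute)
    show "\<rho> x *\<^sub>v w \<in> W" if w: "w \<in> W" for x w
    proof -
      have wc: "w \<in> carrier_vec n" and e: "\<rho> z *\<^sub>v w = c \<cdot>\<^sub>v w" using w by (auto simp: W_def)
      have "\<rho> z *\<^sub>v (\<rho> x *\<^sub>v w) = (\<rho> z * \<rho> x) *\<^sub>v w"
        using assoc_mult_mat_vec[OF D(1) D(1) wc] by simp
      also have "\<rho> z * \<rho> x = \<rho> x * \<rho> z" using z D(4) by metis
      also have "(\<rho> x * \<rho> z) *\<^sub>v w = \<rho> x *\<^sub>v (c \<cdot>\<^sub>v w)"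
        using assoc_mult_mat_vec[OF D(1) D(1) wc] e by simp
      also have "\<dots> = c \<cdot>\<^sub>v (\<rho> x *\<^sub>v w)" using mult_mat_vec[OF D(1) wc] .
      finally show ?thesis using wc mult_mat_vec_carrier[OF D(1) wc] by (auto simp: W_def)
    qed
  qed
  moreover have "v \<in> W" using v by (simp add: W_def)
  ultimately have W: "W = carrier_vec n" using v(2) by blast
  have "\<rho> z = c \<cdot>\<^sub>m 1\<^sub>m n"
  proof (rule mat_eqI_mult_vec[OF D(1)])
    fix w :: "complex vec" assume w: "w \<in> carrier_vec n"
    then have "\<rho> z *\<^sub>v w = c \<cdot>\<^sub>v w" using W by (auto simp: W_def)
    also have "\<dots> = (c \<cdot>\<^sub>m 1\<^sub>m n) *\<^sub>v w" using w by auto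
    finally show "\<rho> z *\<^sub>v w = (c \<cdot>\<^sub>m 1\<^sub>m n) *\<^sub>v w" .
  qed simp
  then show ?thesis by blast
qed

text \<open>The representation is left multiplication on \<open>L\<close>, written in a basis of
  \<open>L\<close>; its invariant subspaces correspond to the left ideals inside \<open>L\<close>.
  The second conclusion records that its kernel annihilates \<open>L\<close>.\<close>

lemma irreducible_representation_on_minimal_left_ideal:
  assumes L: "minimal_left_ideal L"
  shows "\<exists>n \<rho>. is_irreducible_representation n \<rho> \<and> (\<forall>x. \<rho> x = 0\<^sub>m n n \<longrightarrow> (\<forall>y\<in>L. x * y = 0))"
proof -
  have LI: "left_ideal L" "L \<noteq> {0}" using L by (auto simp: minimal_left_ideal_def)
  note LD = left_idealD[OF LI(1)]
  obtain C where C: "C \<subseteq> L" "independent C" "L \<subseteq> span C"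
    using maximal_independent_subset[of L] by blast
  have finC: "finite C" using finiteI_independent[OF C(2)] .
  have spanC: "span C = L" using C span_subspace[OF C(1,3) LD(1)] by simp
  define n where "n = card C"
  obtain h where h: "bij_betw h {..<n} C"
    using ex_bij_betw_nat_finite[OF finC] unfolding n_def atLeast0LessThan by blast
  have hC: "h i \<in> C" "h i \<in> L" if "i < n" for i
    using bij_betwE[OF h] that C(1) by auto
  have h_inj: "h i = h j \<longleftrightarrow> i = j" if "i < n" "j < n" for i j
    using h that unfolding bij_betw_def inj_on_def by auto
  define co where "co x i = representation C x (h i)" for x i
  have co_add: "co (x + y) i = co x i + co y i" if "x \<in> L" "y \<in> L" for x y i
    using that by (simp add: co_def representation_add[OF C(2)] spanC)
  have co_scale: "co (scale c x) i = c * co x i" if "x \<in> L" for x c i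
    using that by (simp add: co_def representation_scale[OF C(2)] spanC)
  have co_h: "co (h j) i = (if i = j then 1 else 0)" if "i < n" "j < n" for i j
    using h_inj[OF that] by (simp add: co_def representation_basis[OF C(2) hC(1)[OF that(2)]])
  \<comment> \<open>\<open>\<psi>\<close> turns a coordinate vector into an element of
    \<open>L\<close> and is inverse to \<open>co\<close>. It intertwines \<open>\<rho> x\<close>
    with left multiplication by \<open>x\<close>, so statements about matrices can be proved in the
    algebra.\<close>
  define \<psi> where "\<psi> w = (\<Sum>i<n. scale (w $ i) (h i))" for w
  have \<psi>_co: "\<psi> (vec n (co x)) = x" if "x \<in> L" for x
  proof -
    have "\<psi> (vec n (co x)) = (\<Sum>i<n. scale (representation C x (h i)) (h i))"
      by (simp add: \<psi>_def co_def)
    also have "\<dots> = (\<Sum>b\<in>C. scale (representation C x b) b)"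
      using sum.reindex_bij_betw[OF h, of "\<lambda>b. scale (representation C x b) b"] .
    also have "\<dots> = x"
      using sum_representation_eq[OF C(2) _ finC, of x] that spanC by simp
    finally show ?thesis .
  qed
  have \<psi>L: "\<psi> w \<in> L" for w
    unfolding \<psi>_def by (rule subspace_sum[OF LD(1)]) (auto intro: LD hC)
  have co_sum: "co (\<Sum>j\<in>S. g j) i = (\<Sum>j\<in>S. co (g j) i)" if "\<And>j. j \<in> S \<Longrightarrow> g j \<in> L" for g i and S :: "nat set"
    using that by (simp add: co_def representation_sum[OF C(2)] spanC)
  have co_\<psi>: "co (\<psi> w) i = w $ i" if "i < n" for w i
  proof -
    have "co (\<psi> w) i = (\<Sum>j<n. w $ j * co (h j) i)"
      unfolding \<psi>_def by (subst co_sum) (simp_all add: co_scale[OF hC(2)] LD hC)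
    also have "\<dots> = (\<Sum>j<n. if j = i then w $ i else 0)"
      using that by (intro sum.cong) (auto simp: co_h)
    finally show ?thesis using that by simp
  qed
  have \<psi>_inj: "v = w" if "\<psi> v = \<psi> w" "v \<in> carrier_vec n" "w \<in> carrier_vec n" for v w
  proof (rule eq_vecI)
    fix i assume "i < dim_vec w"
    then have "i < n" using that by simp
    then show "v $ i = w $ i" using co_\<psi>[of i v] co_\<psi>[of i w] that(1) by simp
  qed (use that in simp)
  have \<psi>_add: "\<psi> (v + w) = \<psi> v + \<psi> w" if "v \<in> carrier_vec n" "w \<in> carrier_vec n" for v w
    using that by (simp add: \<psi>_def scale_left_distrib sum.distrib)
  have \<psi>_smult: "\<psi> (c \<cdot>\<^sub>v w) = scale c (\<psi> w)" if "w \<in> carrier_vec n" for c w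
    using that by (simp add: \<psi>_def scale_sum_right)
  define \<rho> where "\<rho> x = mat n n (\<lambda>(i, j). co (x * h j) i)" for x
  have \<rho>c: "\<rho> x \<in> carrier_mat n n" for x by (simp add: \<rho>_def)
  have mult_\<psi>: "x * \<psi> w = \<psi> (\<rho> x *\<^sub>v w)" if w: "w \<in> carrier_vec n" for x w
  proof -
    have xw: "x * \<psi> w = (\<Sum>j<n. scale (w $ j) (x * h j))"
      by (simp add: \<psi>_def sum_distrib_left scale_mult_right)
    have "\<rho> x *\<^sub>v w = vec n (co (x * \<psi> w))"
    proof (rule eq_vecI)
      fix i assume "i < dim_vec (vec n (co (x * \<psi> w)))"
      then have i: "i < n" by simp
      have "co (x * \<psi> w) i = (\<Sum>j<n. w $ j * co (x * h j) i)"
        unfolding xw by (subst co_sum) (simp_all add: co_scale[OF LD(5)[OF hC(2)]] LD hC)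
      then show "(\<rho> x *\<^sub>v w) $ i = vec n (co (x * \<psi> w)) $ i"
        using i w by (auto simp: \<rho>_def scalar_prod_def atLeast0LessThan intro!: sum.cong)
    qed (simp add: \<rho>_def)
    then show ?thesis using \<psi>_co LD(5)[OF \<psi>L] by simp
  qed
  have rep: "is_representation n \<rho>"
    unfolding is_representation_def
  proof (intro conjI allI)
    show "\<rho> x \<in> carrier_mat n n" for x by (rule \<rho>c)
    show "\<rho> (x + y) = \<rho> x + \<rho> y" for x y
      by (rule eq_matI) (auto simp: \<rho>_def distrib_right co_add intro!: co_add LD hC)
    show "\<rho> (scale c x) = c \<cdot>\<^sub>m \<rho> x" for c x
      by (rule eq_matI) (auto simp: \<rho>_def scale_mult_left intro!: co_scale LD hC)
    show "\<rho> 1 = 1\<^sub>m n"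
      by (rule eq_matI) (auto simp: \<rho>_def co_h)
    \<comment> \<open>Both matrices are applied to a vector and compared under the injective map
      \<open>\<psi>\<close>, where the claim is associativity in the algebra.\<close>
    show "\<rho> (x * y) = \<rho> x * \<rho> y" for x y
    proof (rule mat_eqI_mult_vec)
      show "\<rho> x * \<rho> y \<in> carrier_mat n n" by (rule mult_carrier_mat[OF \<rho>c \<rho>c])
      fix w :: "complex vec" assume w: "w \<in> carrier_vec n"
      have "\<psi> (\<rho> (x * y) *\<^sub>v w) = x * (y * \<psi> w)" by (simp add: mult_\<psi>[OF w, symmetric] mult.assoc)
      also have "\<dots> = \<psi> (\<rho> x *\<^sub>v (\<rho> y *\<^sub>v w))"
        using mult_\<psi>[OF w] mult_\<psi>[OF mult_mat_vec_carrier[OF \<rho>c w]] by simp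
      finally have "\<rho> (x * y) *\<^sub>v w = \<rho> x *\<^sub>v (\<rho> y *\<^sub>v w)"
        by (rule \<psi>_inj) (intro mult_mat_vec_carrier[OF \<rho>c] w)+
      then show "\<rho> (x * y) *\<^sub>v w = (\<rho> x * \<rho> y) *\<^sub>v w"
        using assoc_mult_mat_vec[OF \<rho>c \<rho>c w] by simp
    qed (rule \<rho>c)
  qed
  have n0: "n > 0"
  proof (rule ccontr)
    assume "\<not> n > 0"
    then have "C = {}" using finC n_def by auto
    then show False using spanC LI(2) by auto
  qed
  have "is_irreducible_representation n \<rho>"
  proof (rule is_irreducible_representationI[OF rep n0])
    fix W :: "complex vec set"
    assume W: "W \<subseteq> carrier_vec n" "0\<^sub>v n \<in> W" "\<And>v w. v \<in> W \<Longrightarrow> w \<in> W \<Longrightarrow> v + w \<in> W"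
      "\<And>c v. v \<in> W \<Longrightarrow> c \<cdot>\<^sub>v v \<in> W" "\<And>x v. v \<in> W \<Longrightarrow> \<rho> x *\<^sub>v v \<in> W"
    have \<psi>0: "\<psi> (0\<^sub>v n) = 0" by (simp add: \<psi>_def)
    \<comment> \<open>An invariant subspace becomes a left ideal inside \<open>L\<close>, to which
      minimality applies.\<close>
    have "left_ideal (\<psi> ` W)"
    proof (rule left_idealI)
      show "0 \<in> \<psi> ` W" using \<psi>0 W(2) by force
      show "x + y \<in> \<psi> ` W" if xy: "x \<in> \<psi> ` W" "y \<in> \<psi> ` W" for x y
      proof -
        obtain v w where "v \<in> W" "w \<in> W" "x = \<psi> v" "y = \<psi> w" using xy by blast
        then have "x + y = \<psi> (v + w)" "v + w \<in> W" using \<psi>_add W(1,3) by (simp_all add: subset_iff)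
        then show ?thesis by blast
      qed
      show "scale c x \<in> \<psi> ` W" if x: "x \<in> \<psi> ` W" for c x
      proof -
        obtain v where "v \<in> W" "x = \<psi> v" using x by blast
        then have "scale c x = \<psi> (c \<cdot>\<^sub>v v)" "c \<cdot>\<^sub>v v \<in> W" using \<psi>_smult W(1,4) by (simp_all add: subset_iff)
        then show ?thesis by blast
      qed
      show "a * x \<in> \<psi> ` W" if x: "x \<in> \<psi> ` W" for a x
      proof -
        obtain v where "v \<in> W" "x = \<psi> v" using x by blast
        then have "a * x = \<psi> (\<rho> a *\<^sub>v v)" "\<rho> a *\<^sub>v v \<in> W" using mult_\<psi> W(1,5) by (simp_all add: subset_iff)
        then show ?thesis by blast
      qed
    qed
    moreover have "\<psi> ` W \<subseteq> L" using \<psi>L by blast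
    ultimately consider "\<psi> ` W = {0}" | "\<psi> ` W = L"
      using L unfolding minimal_left_ideal_def by blast
    then show "W = {0\<^sub>v n} \<or> W = carrier_vec n"
    proof cases
      case 1
      then have "w = 0\<^sub>v n" if "w \<in> W" for w
        using \<psi>_inj[of w "0\<^sub>v n"] \<psi>0 W(1) that by auto
      then show ?thesis using W(2) by blast
    next
      case 2
      have "w \<in> W" if w: "w \<in> carrier_vec n" for w
      proof -
        obtain v where v: "v \<in> W" "\<psi> w = \<psi> v" using \<psi>L[of w] 2 by auto
        then have "w = v" using \<psi>_inj[OF v(2) w] W(1) by blast
        then show ?thesis using v by simp
      qed
      then show ?thesis using W(1) by auto
    qed
  qed
  moreover have "x * y = 0" if x: "\<rho> x = 0\<^sub>m n n" and y: "y \<in> L" for x y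
  proof -
    have "x * y = x * \<psi> (vec n (co y))" using \<psi>_co[OF y] by simp
    also have "\<dots> = \<psi> (0\<^sub>m n n *\<^sub>v vec n (co y))" using mult_\<psi>[of "vec n (co y)" x] x by simp
    also have "\<dots> = 0" by (simp add: \<psi>_def)
    finally show ?thesis .
  qed
  ultimately show ?thesis by blast
qed

text \<open>Choose \<open>v\<close> with \<open>\<rho> l *\<^sub>v v\<close> nonzero and map
  \<open>x\<close> in \<open>L\<close> to \<open>\<rho> x *\<^sub>v v\<close>. The image is a
  nonzero invariant subspace, hence everything; the kernel is a left ideal properly inside
  \<open>L\<close>, hence zero. So \<open>L\<close> is isomorphic to the space of the
  representation.\<close>

lemma irreducible_representation_dim_minimal_left_ideal:
  assumes irr: "is_irreducible_representation n \<rho>" and L: "minimal_left_ideal L"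
    and l: "l \<in> L" "\<rho> l \<noteq> 0\<^sub>m n n"
  shows "n = dim L"
proof -
  have LI: "left_ideal L" using L by (auto simp: minimal_left_ideal_def)
  note LD = left_idealD[OF LI]
  note rep = is_irreducible_representationD(1)[OF irr]
  note D = is_representationD[OF rep]
  obtain i j where ij: "i < n" "j < n" "\<rho> l $$ (i, j) \<noteq> 0"
    using l(2) D(6,7)[of l] by (metis eq_matI index_zero_mat)
  define v :: "complex vec" where "v = unit_vec n j"
  have v: "v \<in> carrier_vec n" by (simp add: v_def)
  have lv: "\<rho> l *\<^sub>v v \<noteq> 0\<^sub>v n"
  proof
    assume "\<rho> l *\<^sub>v v = 0\<^sub>v n"
    then have "(\<rho> l *\<^sub>v v) $ i = 0" using ij by simp
    then show False using ij index_mult_mat_unit_vec[OF D(1) ij(1,2)] by (simp add: v_def)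
  qed
  define \<phi> where "\<phi> x = \<rho> x *\<^sub>v v" for x
  have \<phi>c: "\<phi> x \<in> carrier_vec n" for x
    unfolding \<phi>_def by (rule mult_mat_vec_carrier[OF D(1) v])
  have \<phi>_add: "\<phi> (x + y) = \<phi> x + \<phi> y" for x y
    using add_mult_distrib_mat_vec[OF D(1) D(1) v] by (simp add: \<phi>_def D(2))
  have \<phi>_scale: "\<phi> (scale c x) = c \<cdot>\<^sub>v \<phi> x" for c x
    using D(6,7)[of x] v by (auto simp: \<phi>_def D(3))
  have \<phi>_mult: "\<phi> (x * y) = \<rho> x *\<^sub>v \<phi> y" for x y
    using assoc_mult_mat_vec[OF D(1) D(1) v] by (simp add: \<phi>_def D(4))
  have \<phi>0: "\<phi> 0 = 0\<^sub>v n" using v by (auto simp: \<phi>_def is_representation_zero[OF rep] intro!: eq_vecI)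
  have "\<phi> ` L = {0\<^sub>v n} \<or> \<phi> ` L = carrier_vec n"
  proof (rule is_irreducible_representationD(3)[OF irr])
    show "\<phi> ` L \<subseteq> carrier_vec n" using \<phi>c by blast
    show "0\<^sub>v n \<in> \<phi> ` L" using \<phi>0 LD(2) by force
    show "a + b \<in> \<phi> ` L" if "a \<in> \<phi> ` L" "b \<in> \<phi> ` L" for a b
      using that LD(3) by (auto simp: \<phi>_add[symmetric])
    show "c \<cdot>\<^sub>v a \<in> \<phi> ` L" if "a \<in> \<phi> ` L" for c a
      using that LD(4) by (auto simp: \<phi>_scale[symmetric])
    show "\<rho> x *\<^sub>v a \<in> \<phi> ` L" if "a \<in> \<phi> ` L" for x a
      using that LD(5) by (auto simp: \<phi>_mult[symmetric])
  qed
  then have surj: "\<phi> ` L = carrier_vec n" using lv l(1) by (auto simp: \<phi>_def)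
  define K where "K = {x \<in> L. \<phi> x = 0\<^sub>v n}"
  have "\<rho> a *\<^sub>v 0\<^sub>v n = 0\<^sub>v n" for a using D(1)[of a] by auto
  then have "left_ideal K"
    by (intro left_idealI) (auto simp: K_def \<phi>0 \<phi>_add \<phi>_scale \<phi>_mult LD)
  moreover have "K \<subseteq> L" "K \<noteq> L" using l(1) lv by (auto simp: K_def \<phi>_def)
  ultimately have K: "K = {0}" using L unfolding minimal_left_ideal_def by blast
  \<comment> \<open>The preimages \<open>X i\<close> of the unit vectors will form a basis of
    \<open>L\<close> with \<open>n\<close> elements.\<close>
  have "\<exists>x. x \<in> L \<and> \<phi> x = unit_vec n i" if "i < n" for i
    using surj that by (metis imageE unit_vec_carrier)
  then obtain X where X: "\<And>i. i < n \<Longrightarrow> X i \<in> L" "\<And>i. i < n \<Longrightarrow> \<phi> (X i) = unit_vec n i"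
    by metis
  \<comment> \<open>Stated for arbitrary index sets \<open>S\<close> so that induction on
    \<open>S\<close> applies; only the full set \<open>{..<n}\<close> is used later.\<close>
  have coord_sum: "\<phi> (\<Sum>j\<in>S. scale (c j) (X j)) $ i = (if i \<in> S then c i else 0)"
    if "S \<subseteq> {..<n}" "i < n" for S c i
  proof -
    have "finite S" using that finite_subset by blast
    then show ?thesis using that
    proof (induction S)
      case empty then show ?case by (simp add: \<phi>0)
    next
      case (insert a S)
      then have "a < n" by auto
      have "\<phi> (\<Sum>j\<in>insert a S. scale (c j) (X j)) $ i
          = c a * unit_vec n a $ i + \<phi> (\<Sum>j\<in>S. scale (c j) (X j)) $ i"
        using insert \<phi>c \<open>a < n\<close> by (auto simp: \<phi>_add \<phi>_scale X(2) carrier_vecD[OF \<phi>c])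
      also have "\<dots> = (if i \<in> insert a S then c i else 0)"
        using insert by (auto simp: unit_vec_def)
      finally show ?case .
    qed
  qed
  have Xinj: "inj_on X {..<n}"
  proof (rule inj_onI)
    fix i j assume ij: "i \<in> {..<n}" "j \<in> {..<n}" "X i = X j"
    then have "unit_vec n i $ i = (unit_vec n j :: complex vec) $ i" by (metis X(2) lessThan_iff)
    then show "i = j" using ij by (auto simp: unit_vec_def split: if_splits)
  qed
  have indep: "independent (X ` {..<n})"
  proof (rule independent_if_scalars_zero)
    show "finite (X ` {..<n})" by simp
    fix g x assume s: "(\<Sum>x\<in>X ` {..<n}. scale (g x) x) = 0" and "x \<in> X ` {..<n}"
    then obtain i where i: "i < n" "x = X i" by auto
    have "(\<Sum>j<n. scale (g (X j)) (X j)) = 0"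
      using s sum.reindex[OF Xinj, of "\<lambda>x. scale (g x) x"] by simp
    then show "g x = 0" using coord_sum[of "{..<n}" i "\<lambda>j. g (X j)"] i \<phi>0 by auto
  qed
  \<comment> \<open>An element \<open>y\<close> and the combination \<open>s\<close> of the
    \<open>X j\<close> with the coordinates of \<open>\<phi> y\<close> have the same image, so they
    differ by an element of the zero kernel \<open>K\<close>.\<close>
  have spans: "L \<subseteq> span (X ` {..<n})"
  proof
    fix y assume y: "y \<in> L"
    define s where "s = (\<Sum>j<n. scale (\<phi> y $ j) (X j))"
    have sL: "s \<in> L" unfolding s_def by (rule subspace_sum[OF LD(1)]) (auto intro: LD X)
    have "\<phi> s = \<phi> y" using coord_sum[of "{..<n}"] \<phi>c[of y] \<phi>c[of s]
      by (auto simp: s_def intro!: eq_vecI)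
    moreover have "\<phi> (s - y) + \<phi> y = \<phi> s" using \<phi>_add[of "s - y" y] by simp
    ultimately have e: "\<phi> (s - y) + \<phi> y = \<phi> y" by simp
    have "\<phi> (s - y) = 0\<^sub>v n"
    proof (rule eq_vecI)
      fix i assume "i < dim_vec (0\<^sub>v n :: complex vec)"
      then have i: "i < n" by simp
      have "(\<phi> (s - y) + \<phi> y) $ i = \<phi> (s - y) $ i + \<phi> y $ i"
        using i carrier_vecD[OF \<phi>c[of y]] by simp
      then show "\<phi> (s - y) $ i = 0\<^sub>v n $ i" using e i by simp
    qed (simp add: carrier_vecD[OF \<phi>c])
    then have "s - y \<in> K" using LD(6)[OF sL y] by (simp add: K_def)
    then have "y = s" using K by simp
    moreover have "s \<in> span (X ` {..<n})"
      unfolding s_def by (intro span_sum span_scale span_base) simp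
    ultimately show "y \<in> span (X ` {..<n})" by simp
  qed
  have "card (X ` {..<n}) = dim L"
    by (rule basis_card_eq_dim) (use X spans indep in auto)
  then show ?thesis using card_image[OF Xinj] by simp
qed

end

subsection \<open>The trace form\<close>

definition mat_trace :: "'a::comm_monoid_add mat \<Rightarrow> 'a" where
  "mat_trace M = (\<Sum>i<dim_row M. M $$ (i, i))"

lemma mat_trace_mult_commute:
  fixes M N :: "'a::comm_semiring_0 mat"
  assumes "M \<in> carrier_mat m n" "N \<in> carrier_mat n m"
  shows "mat_trace (M * N) = mat_trace (N * M)"
proof -
  have "mat_trace (M * N) = (\<Sum>i<m. \<Sum>j<n. M $$ (i, j) * N $$ (j, i))"
    using assms by (simp add: mat_trace_def scalar_prod_def atLeast0LessThan)
  also have "\<dots> = (\<Sum>j<n. \<Sum>i<m. N $$ (j, i) * M $$ (i, j))"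
    by (subst sum.swap) (simp add: mult.commute)
  also have "\<dots> = mat_trace (N * M)"
    using assms by (simp add: mat_trace_def scalar_prod_def atLeast0LessThan)
  finally show ?thesis .
qed

section \<open>Linear functionals on the algebra and traces of representations\<close>

context based_algebra
begin

lemma functional_sum:
  fixes f :: "'a \<Rightarrow> complex"
  assumes "\<And>x y. f (x + y) = f x + f y"
  shows "f (\<Sum>i\<in>I. g i) = (\<Sum>i\<in>I. f (g i))"
proof -
  have "f 0 = 0" using assms[of 0 0] by simp
  then show ?thesis by (induction I rule: infinite_finite_induct) (simp_all add: assms)
qed

lemma functional_expand:
  fixes f :: "'a \<Rightarrow> complex"
  assumes "\<And>x y. f (x + y) = f x + f y" "\<And>c x. f (scale c x) = c * f x"
  shows "f x = (\<Sum>b\<in>B. representation B x b * f b)"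
proof -
  have "f x = f (\<Sum>b\<in>B. scale (representation B x b) b)"
    using sum_representation_eq[OF independent_Basis _ finite_Basis subset_refl, of x]
    by (simp add: span_Basis)
  then show ?thesis by (simp add: functional_sum[of f] assms)
qed

lemma functional_eqI:
  fixes f g :: "'a \<Rightarrow> complex"
  assumes "\<And>x y. f (x + y) = f x + f y" "\<And>c x. f (scale c x) = c * f x"
    and "\<And>x y. g (x + y) = g x + g y" "\<And>c x. g (scale c x) = c * g x"
    and "\<And>b. b \<in> B \<Longrightarrow> f b = g b"
  shows "f x = g x"
  by (simp add: functional_expand[of f x, OF assms(1,2)] functional_expand[of g x, OF assms(3,4)]
      assms(5))

lemma is_representation_trace:
  assumes "is_representation n \<rho>"
  shows "mat_trace (\<rho> (x + y)) = mat_trace (\<rho> x) + mat_trace (\<rho> y)"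
    "mat_trace (\<rho> (scale c x)) = c * mat_trace (\<rho> x)"
    "mat_trace (\<rho> (x * y)) = mat_trace (\<rho> (y * x))"
    "mat_trace (\<rho> x) = (\<Sum>i<n. \<rho> x $$ (i, i))"
    "mat_trace (\<rho> 1) = of_nat n"
  using mat_trace_mult_commute[OF is_representationD(1,1)[OF assms], of x y]
  by (simp_all add: mat_trace_def is_representationD(2-7)[OF assms] sum.distrib sum_distrib_left)

end

section \<open>The coefficient of the identity as a faithful positive trace\<close>

context C_algebra
begin

text \<open>This is the functional \<open>\<tau>\<close> of the overview; the standard feasible
  trace is its multiple by \<open>total_degree\<close>.\<close>

definition unit_coeff :: "'a \<Rightarrow> complex" where
  "unit_coeff x = representation B x 1"

lemma unit_coeff_add: "unit_coeff (x + y) = unit_coeff x + unit_coeff y"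
  by (simp add: unit_coeff_def representation_add[OF independent_Basis] span_Basis)

lemma unit_coeff_scale: "unit_coeff (scale c x) = c * unit_coeff x"
  by (simp add: unit_coeff_def representation_scale[OF independent_Basis] span_Basis)

lemma unit_coeff_zero: "unit_coeff 0 = 0"
  using unit_coeff_add[of 0 0] by simp

lemma unit_coeff_diff: "unit_coeff (x - y) = unit_coeff x - unit_coeff y"
  using unit_coeff_add[of "x - y" y] by simp

lemmas unit_coeff_linear = unit_coeff_add unit_coeff_scale unit_coeff_diff unit_coeff_zero

lemma star_in_basis: "b \<in> B \<Longrightarrow> star b \<in> B"
  using star_basis by blast

lemma degree_map_basis:
  assumes "b \<in> B"
  shows "degree_map b = of_real (basis_degree b)"
proof -
  have "degree_map b = (\<Sum>a\<in>B. if a = b then of_real (basis_degree b) else 0)"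
    unfolding degree_map_def
    by (intro sum.cong) (auto simp: representation_basis[OF independent_Basis assms])
  then show ?thesis using assms finite_Basis by simp
qed

text \<open>The degree map turns \<open>star\<close> into complex conjugation and takes real values
  on \<open>B\<close>.\<close>

lemma basis_degree_star: "b \<in> B \<Longrightarrow> basis_degree (star b) = basis_degree b"
  using degree_map_star[of b] by (simp add: degree_map_basis star_in_basis)

lemma unit_coeff_mult_basis:
  "a \<in> B \<Longrightarrow> b \<in> B \<Longrightarrow> unit_coeff (a * b) = (if a = star b then of_real (basis_degree a) else 0)"
  using structure_constant_one by (simp add: structure_constant_def unit_coeff_def)

text \<open>For basis elements both sides vanish unless \<open>a = star b\<close>, which is the same
  as \<open>b = star a\<close>; in that case the values are the degrees of \<open>a\<close> and
  \<open>star a\<close>, which agree. Linearity in each argument extends this to the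
  algebra.\<close>

lemma unit_coeff_mult_commute: "unit_coeff (x * y) = unit_coeff (y * x)"
proof -
  have *: "unit_coeff (x * b) = unit_coeff (b * x)" if b: "b \<in> B" for x b
  proof (rule functional_eqI[where f = "\<lambda>x. unit_coeff (x * b)" and g = "\<lambda>x. unit_coeff (b * x)"])
    fix a assume a: "a \<in> B"
    have "a = star b \<longleftrightarrow> b = star a" using star_star by metis
    then show "unit_coeff (a * b) = unit_coeff (b * a)"
      using a b by (auto simp: unit_coeff_mult_basis basis_degree_star)
  qed (simp_all add: distrib_left distrib_right scale_mult_left scale_mult_right unit_coeff_linear)
  show ?thesis
    by (rule functional_eqI[where f = "\<lambda>y. unit_coeff (x * y)" and g = "\<lambda>y. unit_coeff (y * x)"])
      (simp_all add: distrib_left distrib_right scale_mult_left scale_mult_right unit_coeff_linear *)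
qed

text \<open>The basis is orthogonal for the form \<open>unit_coeff (x * star y)\<close>, and the
  squared norm of \<open>b\<close> is its degree.\<close>

lemma unit_coeff_mult_star:
  "unit_coeff (x * star x) = (\<Sum>b\<in>B. of_real ((cmod (representation B x b))\<^sup>2 * basis_degree b))"
proof -
  have a: "unit_coeff (a * star x) = cnj (representation B x a) * of_real (basis_degree a)"
    if a: "a \<in> B" for a
  proof -
    \<comment> \<open>Conjugating compensates for the semilinearity of \<open>star\<close>: this
      expression is linear in \<open>x\<close> and can be expanded in the basis.\<close>
    have "cnj (unit_coeff (a * star x))
        = (\<Sum>b\<in>B. representation B x b * cnj (unit_coeff (a * star b)))"
      by (rule functional_expand)
        (simp_all add: star_add star_scale distrib_left scale_mult_right unit_coeff_linear)
    also have "\<dots> = (\<Sum>b\<in>B. if b = a then representation B x a * of_real (basis_degree a) else 0)"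
      using a by (intro sum.cong) (auto simp: unit_coeff_mult_basis star_in_basis star_star)
    also have "\<dots> = representation B x a * of_real (basis_degree a)"
      using a finite_Basis by simp
    finally have "cnj (cnj (unit_coeff (a * star x))) =
        cnj (representation B x a * of_real (basis_degree a))" by simp
    then show ?thesis by simp
  qed
  have "unit_coeff (x * star x) = (\<Sum>b\<in>B. representation B x b * unit_coeff (b * star x))"
    by (rule functional_expand) (simp_all add: distrib_right scale_mult_left unit_coeff_linear)
  also have "\<dots> = (\<Sum>b\<in>B. of_real ((cmod (representation B x b))\<^sup>2 * basis_degree b))"
    by (intro sum.cong) (simp_all only: a of_real_mult complex_norm_square mult.assoc)
  finally show ?thesis .
qed

lemma unit_coeff_mult_star_eq_0:
  assumes "unit_coeff (x * star x) = 0"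
  shows "x = 0"
proof -
  have "(\<Sum>b\<in>B. (cmod (representation B x b))\<^sup>2 * basis_degree b) = 0"
    using assms unfolding unit_coeff_mult_star by (simp only: of_real_sum[symmetric] of_real_eq_0_iff)
  then have "(cmod (representation B x b))\<^sup>2 * basis_degree b = 0" if "b \<in> B" for b
    using sum_nonneg_eq_0_iff[OF finite_Basis, of "\<lambda>b. (cmod (representation B x b))\<^sup>2 * basis_degree b"]
      basis_degree_pos that by (simp add: less_imp_le)
  then have "representation B x b = 0" if "b \<in> B" for b
    using basis_degree_pos[OF that] that by fastforce
  then have "(\<Sum>b\<in>B. scale (representation B x b) b) = 0" by simp
  then show ?thesis
    using sum_representation_eq[OF independent_Basis _ finite_Basis subset_refl, of x]
    by (simp add: span_Basis)
qed

lemma unit_coeff_nondegenerate: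
  assumes "\<And>x. unit_coeff (x * w) = 0"
  shows "w = 0"
  using assms[of "star w"] unit_coeff_mult_commute[of w "star w"] unit_coeff_mult_star_eq_0[of w]
  by simp

section \<open>Duality and orthogonal projection for the trace form\<close>

lemma functional_eq_unit_coeff:
  fixes f :: "'a \<Rightarrow> complex"
  assumes "\<And>x y. f (x + y) = f x + f y" "\<And>c x. f (scale c x) = c * f x"
  shows "\<exists>z. \<forall>x. f x = unit_coeff (x * z)"
proof -
  \<comment> \<open>Under the pairing \<open>unit_coeff (x * y)\<close> the elements
    \<open>star b\<close> divided by the degree of \<open>b\<close> are dual to the basis
    \<open>B\<close>, which dictates the coefficients of \<open>z\<close>.\<close>
  define z where "z = (\<Sum>b\<in>B. scale (f b / of_real (basis_degree b)) (star b))"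
  have "f x = unit_coeff (x * z)" for x
  proof (rule functional_eqI[of f "\<lambda>x. unit_coeff (x * z)"])
    fix a assume a: "a \<in> B"
    have "unit_coeff (a * z) = (\<Sum>b\<in>B. f b / of_real (basis_degree b) * unit_coeff (a * star b))"
      unfolding z_def sum_distrib_left
      by (simp add: functional_sum[of unit_coeff] unit_coeff_linear scale_mult_right)
    also have "\<dots> = (\<Sum>b\<in>B. if b = a then f a else 0)"
      using a basis_degree_pos[of a]
      by (intro sum.cong) (auto simp: unit_coeff_mult_basis star_in_basis star_star)
    also have "\<dots> = f a" using a finite_Basis by simp
    finally show "f a = unit_coeff (a * z)" by simp
  qed (simp_all add: assms distrib_right scale_mult_left unit_coeff_linear)
  then show ?thesis by blast
qed

text \<open>Let \<open>z\<close> represent \<open>f\<close>. Traciality of both functionals makes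
  \<open>z * y - y * z\<close> pair to zero with every \<open>x\<close>, so nondegeneracy forces
  \<open>z\<close> to be central.\<close>

lemma trace_functional_eq_unit_coeff:
  fixes f :: "'a \<Rightarrow> complex"
  assumes "\<And>x y. f (x + y) = f x + f y" "\<And>c x. f (scale c x) = c * f x"
    and comm: "\<And>x y. f (x * y) = f (y * x)"
  shows "\<exists>z. (\<forall>x. z * x = x * z) \<and> (\<forall>x. f x = unit_coeff (x * z))"
proof -
  obtain z where z: "\<And>x. f x = unit_coeff (x * z)"
    using functional_eq_unit_coeff[of f] assms(1,2) by blast
  have "z * y - y * z = 0" for y
  proof (rule unit_coeff_nondegenerate)
    fix x
    have "unit_coeff (x * (z * y - y * z)) = unit_coeff ((x * z) * y) - unit_coeff (x * y * z)"
      by (simp add: right_diff_distrib unit_coeff_linear mult.assoc)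
    also have "unit_coeff ((x * z) * y) = f (y * x)"
      unfolding unit_coeff_mult_commute[of "x * z" y] by (simp add: z mult.assoc)
    also have "unit_coeff (x * y * z) = f (x * y)" by (simp add: z)
    finally show "unit_coeff (x * (z * y - y * z)) = 0" using comm[of x y] by simp
  qed
  then show ?thesis using z by auto
qed

text \<open>Gram-Schmidt by induction on the spanning set. The vector \<open>x\<close> is kept
  arbitrary because the induction hypothesis is needed for \<open>x\<close> and for the new
  generator \<open>v\<close>.\<close>

lemma orthogonal_projection_exists:
  assumes "finite S"
  shows "\<exists>y\<in>span S. \<forall>s\<in>span S. unit_coeff ((x - y) * star s) = 0"
  using assms
proof (induction S arbitrary: x rule: finite_induct)
  case empty
  have "star 0 = 0" using star_add[of 0 0] by simp
  then show ?case by (simp add: unit_coeff_zero)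
next
  case (insert v S)
  obtain p where p: "p \<in> span S" "\<And>s. s \<in> span S \<Longrightarrow> unit_coeff ((v - p) * star s) = 0"
    using insert.IH[of v] by blast
  obtain y where y: "y \<in> span S" "\<And>s. s \<in> span S \<Longrightarrow> unit_coeff ((x - y) * star s) = 0"
    using insert.IH[of x] by blast
  define w where "w = v - p"
  \<comment> \<open>\<open>w\<close> is the part of \<open>v\<close> orthogonal to
    \<open>span S\<close>, and \<open>t\<close> is the coefficient of \<open>x - y\<close> along
    \<open>w\<close>. If \<open>w = 0\<close> the denominator vanishes, but then the value of
    \<open>t\<close> is irrelevant.\<close>
  define t where "t = unit_coeff ((x - y) * star w) / unit_coeff (w * star w)"
  define y' where "y' = y + scale t w"
  have ins: "span S \<subseteq> span (insert v S)" by (rule span_mono) blast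
  have "y' \<in> span (insert v S)"
    unfolding y'_def w_def
    by (intro span_add span_scale span_diff subsetD[OF ins] p(1) y(1) span_base insertI1)
  moreover have "unit_coeff ((x - y') * star s) = 0" if s: "s \<in> span (insert v S)" for s
  proof -
    obtain k where k: "s - scale k v \<in> span S" using s span_breakdown_eq by blast
    \<comment> \<open>Every \<open>s\<close> in the larger span splits as
      \<open>s0 + scale k w\<close> with \<open>s0\<close> in \<open>span S\<close>, so
      orthogonality is checked against \<open>s0\<close> and \<open>w\<close> separately.\<close>
    define s0 where "s0 = s - scale k v + scale k p"
    have s0: "s0 \<in> span S" unfolding s0_def using k p(1) by (intro span_add span_scale)
    have s_eq: "s = s0 + scale k w" by (simp add: s0_def w_def scale_right_diff_distrib)
    have xy': "x - y' = (x - y) - scale t w" by (simp add: y'_def)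
    have split: "unit_coeff ((x - y') * star r)
        = unit_coeff ((x - y) * star r) - t * unit_coeff (w * star r)" for r
      unfolding xy' left_diff_distrib[of "x - y"] by (simp add: scale_mult_left unit_coeff_linear)
    have 1: "unit_coeff ((x - y') * star s0) = 0"
      unfolding split using y(2)[OF s0] p(2)[OF s0] by (simp add: w_def)
    have 2: "unit_coeff ((x - y') * star w) = 0"
    proof (cases "w = 0")
      case True
      have "star 0 = 0" using star_add[of 0 0] by simp
      then show ?thesis using True by (simp add: unit_coeff_zero)
    next
      case False
      then have "unit_coeff (w * star w) \<noteq> 0" using unit_coeff_mult_star_eq_0 by blast
      then show ?thesis
        unfolding split by (simp add: t_def)
    qed
    show ?thesis
      unfolding s_eq star_add star_scale distrib_left scale_mult_right
      by (simp add: unit_coeff_linear 1 2)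
  qed
  ultimately show ?case by blast
qed

text \<open>
  The unit of the ideal is the projection of \<open>1\<close> onto it; being orthogonal to a two-sided ideal is
  preserved by multiplication on either side, by traciality.
\<close>

lemma two_sided_ideal_unit:
  assumes J: "left_ideal J" and right: "\<And>x a. x \<in> J \<Longrightarrow> x * a \<in> J"
  shows "\<exists>u\<in>J. (\<forall>a. u * a = a * u) \<and> (\<forall>x\<in>J. x * u = x)"
proof -
  note JD = left_idealD[OF J]
  obtain S where S: "S \<subseteq> J" "independent S" "J \<subseteq> span S"
    using maximal_independent_subset[of J] by blast
  have spanS: "span S = J" using span_subspace[OF S(1,3) JD(1)] .
  obtain u where u: "u \<in> J" "\<And>s. s \<in> J \<Longrightarrow> unit_coeff ((1 - u) * star s) = 0"
    using orthogonal_projection_exists[OF finiteI_independent[OF S(2)], of 1] unfolding spanS by blast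
  \<comment> \<open>By traciality the squared norm of \<open>x - x * u\<close> is the pairing of
    \<open>1 - u\<close> with an element of \<open>J\<close>, hence zero; faithfulness
    finishes.\<close>
  have R: "x * u = x" if x: "x \<in> J" for x
  proof -
    have xu: "x - x * u \<in> J" using JD(5,6) x u(1) by blast
    have "unit_coeff ((x - x * u) * star (x - x * u)) = unit_coeff (x * ((1 - u) * star (x - x * u)))"
      by (simp add: algebra_simps)
    also have "\<dots> = unit_coeff ((1 - u) * (star (x - x * u) * x))"
      by (subst unit_coeff_mult_commute) (simp add: mult.assoc)
    also have "star (x - x * u) * x = star (star x * (x - x * u))" by (simp add: star_mult star_star)
    also have "unit_coeff ((1 - u) * \<dots>) = 0" using u(2) JD(5)[OF xu] by blast
    finally show ?thesis using unit_coeff_mult_star_eq_0 by fastforce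
  qed
  have L: "u * x = x" if x: "x \<in> J" for x
  proof -
    have xu: "x - u * x \<in> J" using JD(6) x right[OF u(1)] by blast
    have "unit_coeff ((x - u * x) * star (x - u * x)) = unit_coeff ((1 - u) * (x * star (x - u * x)))"
      by (simp add: algebra_simps)
    also have "x * star (x - u * x) = star ((x - u * x) * star x)" by (simp add: star_mult star_star)
    also have "unit_coeff ((1 - u) * \<dots>) = 0" using u(2) right[OF xu] by blast
    finally show ?thesis using unit_coeff_mult_star_eq_0 by fastforce
  qed
  \<comment> \<open>Both products lie in \<open>J\<close>, so the unit laws on the right and on the
    left make each of them equal to \<open>u * a * u\<close>.\<close>
  have "u * a = a * u" for a
    using R[OF right[OF u(1)], of a] L[OF JD(5)[OF u(1)], of a] by (simp add: mult.assoc)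
  then show ?thesis using u(1) R by blast
qed

subsection \<open>Irreducible characters and central idempotents\<close>

text \<open>
  \<open>e\<close> is the unit of the block of \<open>\<rho>\<close>: the central idempotent with \<open>ker \<rho> = A (1 - e)\<close>.
\<close>

definition character_support :: "('a \<Rightarrow> complex) \<Rightarrow> 'a \<Rightarrow> nat \<Rightarrow> ('a \<Rightarrow> complex mat) \<Rightarrow> bool" where
  "character_support \<chi> e n \<rho> \<longleftrightarrow> is_irreducible_representation n \<rho> \<and> (\<forall>x. \<chi> x = mat_trace (\<rho> x)) \<and>
     (\<forall>x. e * x = x * e) \<and> \<rho> e = 1\<^sub>m n \<and> (\<forall>x. \<rho> x = 0\<^sub>m n n \<longrightarrow> x * e = 0)"

lemma character_supportD:
  assumes "character_support \<chi> e n \<rho>"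
  shows "is_irreducible_representation n \<rho>" "is_representation n \<rho>" "n > 0"
    "\<chi> x = mat_trace (\<rho> x)" "e * x = x * e" "\<rho> e = 1\<^sub>m n" "\<rho> x = 0\<^sub>m n n \<Longrightarrow> x * e = 0"
  using assms is_irreducible_representationD(1,2) unfolding character_support_def by blast+

lemma one_mat_neq_zero_mat: "n > 0 \<Longrightarrow> 1\<^sub>m n \<noteq> (0\<^sub>m n n :: complex mat)"
  by (metis index_one_mat(1) index_zero_mat(1) zero_neq_one)

text \<open>\<open>1 - e\<close> lies in the kernel of \<open>\<rho>\<close> and is therefore
  annihilated by \<open>e\<close>.\<close>

lemma character_support_idem:
  assumes "character_support \<chi> e n \<rho>"
  shows "e * e = e" "e \<noteq> 0"
proof -
  note D = character_supportD[OF assms]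
  have "\<rho> (1 - e) = 0\<^sub>m n n"
    unfolding is_representation_diff[OF D(2)] D(6) is_representationD(5)[OF D(2)] by (rule eq_matI) auto
  then have "(1 - e) * e = 0" by (rule D(7))
  then show "e * e = e" by (simp add: left_diff_distrib)
  show "e \<noteq> 0"
    using D(6) is_representation_zero[OF D(2)] one_mat_neq_zero_mat[OF D(3)] by metis
qed

text \<open>The kernel of \<open>\<rho>\<close> is a two-sided ideal and so has a central unit
  \<open>u\<close>; the support is \<open>1 - u\<close>.\<close>

lemma character_support_exists:
  assumes irr: "is_irreducible_representation n \<rho>"
  shows "\<exists>e. character_support (\<lambda>x. mat_trace (\<rho> x)) e n \<rho>"
proof -
  note rep = is_irreducible_representationD(1)[OF irr]
  note D = is_representationD[OF rep]
  define J where "J = {x. \<rho> x = 0\<^sub>m n n}"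
  have "left_ideal J"
  proof (rule left_idealI)
    show "0 \<in> J" by (simp add: J_def is_representation_zero[OF rep])
    show "x + y \<in> J" if "x \<in> J" "y \<in> J" for x y using that by (simp add: J_def D(2))
    show "scale c x \<in> J" if "x \<in> J" for c x using that by (auto simp: J_def D(3))
    show "a * x \<in> J" if "x \<in> J" for a x
      using that right_mult_zero_mat[OF D(1)] by (simp add: J_def D(4))
  qed
  moreover have "x * a \<in> J" if "x \<in> J" for a x
    using that left_mult_zero_mat[OF D(1)] by (simp add: J_def D(4))
  ultimately obtain u where u: "u \<in> J" "\<And>a. u * a = a * u" "\<And>x. x \<in> J \<Longrightarrow> x * u = x"
    using two_sided_ideal_unit by blast
  have "\<rho> (1 - u) = 1\<^sub>m n"
    using u(1) unfolding is_representation_diff[OF rep] J_def D(5) by auto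
  then have "character_support (\<lambda>x. mat_trace (\<rho> x)) (1 - u) n \<rho>"
    unfolding character_support_def using irr u(2,3) by (auto simp: algebra_simps J_def)
  then show ?thesis by blast
qed

text \<open>Represent \<open>\<chi>\<close> by a central \<open>z\<close>. By Schur's lemma
  \<open>\<rho> z\<close> is a scalar \<open>c\<close>, so \<open>z - scale c 1\<close> is in the
  kernel and \<open>z * e = scale c e\<close>. As \<open>\<rho> e\<close> is the identity,
  \<open>\<chi> x = \<chi> (x * e)\<close>. Finally \<open>c\<close> is nonzero because
  \<open>\<chi> 1 = n\<close> is.\<close>

lemma character_eq_unit_coeff:
  assumes "character_support \<chi> e n \<rho>"
  shows "\<exists>c. c \<noteq> 0 \<and> (\<forall>x. \<chi> x = c * unit_coeff (x * e))"
proof -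
  note D = character_supportD[OF assms]
  note T = is_representation_trace[OF D(2)]
  obtain z where z: "\<And>x. z * x = x * z" "\<And>x. \<chi> x = unit_coeff (x * z)"
    using trace_functional_eq_unit_coeff[of \<chi>] T(1-3) unfolding D(4) by blast
  obtain c where c: "\<rho> z = c \<cdot>\<^sub>m 1\<^sub>m n" using schur[OF D(1) z(1)] by blast
  have "\<rho> (z - scale c 1) = 0\<^sub>m n n"
    unfolding is_representation_diff[OF D(2)] is_representationD(3,5)[OF D(2)] c
    by (rule eq_matI) auto
  then have "(z - scale c 1) * e = 0" by (rule D(7))
  then have ze: "z * e = scale c e" by (simp add: left_diff_distrib scale_mult_left)
  have \<chi>: "\<chi> x = c * unit_coeff (x * e)" for x
  proof -
    have "\<chi> x = \<chi> (x * e)"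
      using right_mult_one_mat[OF is_representationD(1)[OF D(2)], of x]
      by (simp add: D(4) is_representationD(4)[OF D(2)] D(6))
    also have "\<dots> = unit_coeff (x * (z * e))" by (simp add: z mult.assoc)
    finally show ?thesis by (simp add: ze scale_mult_right unit_coeff_linear)
  qed
  have "\<chi> 1 \<noteq> 0" using T(5) D(3,4) by simp
  then show ?thesis using \<chi> by auto
qed

text \<open>The solutions of \<open>x * g = x\<close> form a left ideal containing \<open>g\<close>,
  and a minimal left ideal is taken inside it.\<close>

lemma minimal_left_ideal_in_corner:
  assumes "g * g = g" "g \<noteq> 0"
  shows "\<exists>L l. minimal_left_ideal L \<and> l \<in> L \<and> l \<noteq> 0 \<and> l * g = l"
proof -
  have "left_ideal {x. x * g = x}"
    by (rule left_idealI) (auto simp: distrib_right scale_mult_left mult.assoc)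
  moreover have "{x. x * g = x} \<noteq> {0}" using assms by blast
  ultimately obtain L where L: "minimal_left_ideal L" "L \<subseteq> {x. x * g = x}"
    using minimal_left_ideal_exists by blast
  moreover have "0 \<in> L" "L \<noteq> {0}"
    using L(1) left_idealD(2) by (auto simp: minimal_left_ideal_def)
  ultimately show ?thesis by blast
qed

text \<open>By Schur's lemma \<open>e\<close> acts by a scalar \<open>c\<close> with
  \<open>c * c = c\<close>.\<close>

lemma irreducible_representation_central_idempotent:
  assumes irr: "is_irreducible_representation n \<rho>" and e: "\<And>x. e * x = x * e" "e * e = e"
  shows "\<rho> e = 0\<^sub>m n n \<or> \<rho> e = 1\<^sub>m n"
proof -
  note rep = is_irreducible_representationD(1)[OF irr]
  have n: "n > 0" using is_irreducible_representationD(2)[OF irr] .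
  obtain c where c: "\<rho> e = c \<cdot>\<^sub>m 1\<^sub>m n" using schur[OF irr e(1)] by blast
  have "\<rho> e * \<rho> e = \<rho> e" using is_representationD(4)[OF rep, of e e] e(2) by simp
  then have "((c \<cdot>\<^sub>m 1\<^sub>m n) * (c \<cdot>\<^sub>m 1\<^sub>m n)) $$ (0, 0) = (c \<cdot>\<^sub>m 1\<^sub>m n) $$ (0, 0)" by (simp add: c)
  then have "c * c = c" using n by simp
  then have "c = 0 \<or> c = 1" by simp
  then show ?thesis unfolding c by (auto intro: eq_matI)
qed

text \<open>
  Two representations with the same block have proportional characters; the factor is \<open>1\<close> because
  their dimensions agree, both being the dimension of a minimal left ideal inside the block.
\<close>

lemma character_support_orthogonal:
  assumes 1: "character_support \<chi> e n \<rho>" and 2: "character_support \<chi>' e' n' \<rho>'"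
  shows "e * e' = 0 \<or> e = e' \<and> \<chi> = \<chi>'"
proof (cases "e * e' = 0")
  case False
  \<comment> \<open>The central idempotent \<open>e\<close> acts under \<open>\<sigma>\<close> as
    zero or as the identity. Zero would give \<open>e * f = 0\<close>, so \<open>1 - e\<close> is in
    the kernel of \<open>\<sigma>\<close> and is annihilated by \<open>f\<close>.\<close>
  have absorb: "f = e * f" if s: "character_support \<phi> f m \<sigma>" and s': "character_support \<psi> e k \<tau>"
    and ne: "e * f \<noteq> 0" for \<phi> \<psi> e f m k \<sigma> \<tau>
  proof -
    note D = character_supportD[OF s]
    have "\<sigma> e \<noteq> 0\<^sub>m m m" using D(7)[of e] ne by blast
    then have "\<sigma> e = 1\<^sub>m m"
      using irreducible_representation_central_idempotent[OF D(1) character_supportD(5)[OF s']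
        character_support_idem(1)[OF s']] by blast
    then have "\<sigma> (1 - e) = 0\<^sub>m m m"
      unfolding is_representation_diff[OF D(2)] is_representationD(5)[OF D(2)]
      by (auto intro: eq_matI)
    then have "(1 - e) * f = 0" by (rule D(7))
    then show ?thesis by (simp add: left_diff_distrib)
  qed
  note D = character_supportD[OF 1] and D' = character_supportD[OF 2]
  have comm: "e * e' = e' * e" by (rule D(5))
  have "e' = e * e'" using absorb[OF 2 1 False] .
  moreover have "e = e' * e" using absorb[OF 1 2] False comm by simp
  ultimately have e: "e = e'" using comm by simp
  obtain L l where L: "minimal_left_ideal L" "l \<in> L" "l \<noteq> 0" "l * e = l"
    using minimal_left_ideal_in_corner[OF character_support_idem[OF 1]] by blast
  \<comment> \<open>A representation killing \<open>l\<close> would give \<open>l * e = 0\<close>,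
    but \<open>l * e = l\<close> is nonzero; so both dimensions equal that of
    \<open>L\<close>.\<close>
  have "\<rho> l \<noteq> 0\<^sub>m n n" "\<rho>' l \<noteq> 0\<^sub>m n' n'" using D(7)[of l] D'(7)[of l] L e by auto
  then have n: "n = n'"
    using irreducible_representation_dim_minimal_left_ideal[OF D(1) L(1,2)]
      irreducible_representation_dim_minimal_left_ideal[OF D'(1) L(1,2)] by simp
  obtain c where c: "\<And>x. \<chi> x = c * unit_coeff (x * e)" using character_eq_unit_coeff[OF 1] by blast
  obtain c' where c': "\<And>x. \<chi>' x = c' * unit_coeff (x * e)"
    using character_eq_unit_coeff[OF 2] e by blast
  have "\<chi> 1 = \<chi>' 1" "\<chi> 1 \<noteq> 0"
    using is_representation_trace(5)[OF D(2)] is_representation_trace(5)[OF D'(2)] n D(3,4) D'(4)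
    by simp_all
  then have "c = c'" using c[of 1] c'[of 1] by auto
  then show ?thesis using e c c' by auto
qed simp

text \<open>Up to the factor \<open>c\<close>, this is the nonzero value
  \<open>\<chi> 1 = n\<close>.\<close>

lemma character_support_unit_coeff_neq_0:
  assumes "character_support \<chi> e n \<rho>"
  shows "unit_coeff e \<noteq> 0"
proof -
  note D = character_supportD[OF assms]
  obtain c where "\<chi> 1 = c * unit_coeff (1 * e)" using character_eq_unit_coeff[OF assms] by blast
  moreover have "\<chi> 1 \<noteq> 0" using is_representation_trace(5)[OF D(2)] D(3,4) by simp
  ultimately show ?thesis by auto
qed

text \<open>Different supports would be orthogonal; then \<open>\<chi> e\<close> would be nonzero
  when computed with \<open>e\<close> and zero when computed with \<open>e'\<close>. Thus the
  support depends on the character alone.\<close>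

lemma character_support_unique:
  assumes 1: "character_support \<chi> e n \<rho>" and 2: "character_support \<chi> e' n' \<rho>'"
  shows "e = e'"
proof (rule ccontr)
  assume "e \<noteq> e'"
  then have "e * e' = 0" using character_support_orthogonal[OF 1 2] by blast
  moreover obtain c where "c \<noteq> 0" "\<chi> e = c * unit_coeff (e * e)"
    using character_eq_unit_coeff[OF 1] by blast
  moreover obtain c' where "\<chi> e = c' * unit_coeff (e * e')"
    using character_eq_unit_coeff[OF 2] by blast
  ultimately show False
    using character_support_idem(1)[OF 1] character_support_unit_coeff_neq_0[OF 1]
    by (simp add: unit_coeff_zero)
qed

section \<open>Decomposition of the identity and the family of multiplicities\<close>

lemma Irr_iff_character_support: "\<chi> \<in> Irr \<longleftrightarrow> (\<exists>e n \<rho>. character_support \<chi> e n \<rho>)"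
proof
  assume "\<chi> \<in> Irr"
  then obtain n \<rho> where r: "is_irreducible_representation n \<rho>" "\<And>x. \<chi> x = (\<Sum>i<n. \<rho> x $$ (i, i))"
    unfolding Irr_def by blast
  then have "\<chi> = (\<lambda>x. mat_trace (\<rho> x))"
    using is_representation_trace(4)[OF is_irreducible_representationD(1)[OF r(1)]] by auto
  then show "\<exists>e n \<rho>. character_support \<chi> e n \<rho>" using character_support_exists[OF r(1)] by auto
next
  assume "\<exists>e n \<rho>. character_support \<chi> e n \<rho>"
  then obtain e n \<rho> where s: "character_support \<chi> e n \<rho>" by blast
  note D = character_supportD[OF s]
  have "\<chi> x = (\<Sum>i<n. \<rho> x $$ (i, i))" for x using D(4) is_representation_trace(4)[OF D(2)] by simp
  then show "\<chi> \<in> Irr" using D(1) unfolding Irr_def by blast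
qed

text \<open>Multiplying a linear relation by one of the idempotents isolates its coefficient. In
  finite dimension this bounds the number of characters.\<close>

lemma independent_orthogonal_idempotents:
  assumes orth: "\<And>e f. e \<in> E \<Longrightarrow> f \<in> E \<Longrightarrow> e \<noteq> f \<Longrightarrow> e * f = 0"
    and idem: "\<And>e. e \<in> E \<Longrightarrow> e * e = e" "\<And>e. e \<in> E \<Longrightarrow> e \<noteq> 0"
  shows "independent E"
  unfolding independent_explicit_finite_subsets
proof (intro allI impI ballI)
  fix S u v assume S: "S \<subseteq> E" "finite S" and s: "(\<Sum>v\<in>S. scale (u v) v) = 0" and v: "v \<in> S"
  have "0 = (\<Sum>w\<in>S. scale (u w) w) * v" using s by simp
  also have "\<dots> = (\<Sum>w\<in>S. scale (u w) (w * v))" by (simp add: sum_distrib_right scale_mult_left)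
  also have "\<dots> = (\<Sum>w\<in>S. if w = v then scale (u v) v else 0)"
    using S(1) v by (intro sum.cong) (auto simp: idem orth subset_iff)
  also have "\<dots> = scale (u v) v" using S(2) v by simp
  finally show "u v = 0" using idem(2)[of v] S(1) v by (metis scale_eq_0_iff subsetD)
qed

text \<open>Once the supports sum to \<open>1\<close>, \<open>unit_coeff x\<close> is the sum of the
  \<open>unit_coeff (x * E \<chi>)\<close>, that is of the \<open>\<chi> x / c \<chi>\<close>. The
  multiplicity is therefore \<open>total_degree / c \<chi>\<close>.\<close>

lemma standard_feasible_multiplicity_unique_exists:
  "\<exists>!m. m \<in> Irr \<rightarrow>\<^sub>E - {0} \<and> (\<forall>x. standard_feasible_trace x = (\<Sum>\<chi>\<in>Irr. m \<chi> * \<chi> x))"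
proof -
  obtain E where E: "\<And>\<chi>. \<chi> \<in> Irr \<Longrightarrow> \<exists>n \<rho>. character_support \<chi> (E \<chi>) n \<rho>"
    using Irr_iff_character_support by metis
  have idem: "E \<chi> * E \<chi> = E \<chi>" "E \<chi> \<noteq> 0" "unit_coeff (E \<chi>) \<noteq> 0" if "\<chi> \<in> Irr" for \<chi>
    using E[OF that] character_support_idem character_support_unit_coeff_neq_0 by blast+
  have central: "E \<chi> * x = x * E \<chi>" if "\<chi> \<in> Irr" for \<chi> x
    using E[OF that] character_supportD(5) by blast
  have orth: "E \<chi> * E \<chi>' = 0" if "\<chi> \<in> Irr" "\<chi>' \<in> Irr" "\<chi> \<noteq> \<chi>'" for \<chi> \<chi>'
    using E[OF that(1)] E[OF that(2)] character_support_orthogonal that(3) by blast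
  obtain c where c: "\<And>\<chi>. \<chi> \<in> Irr \<Longrightarrow> c \<chi> \<noteq> 0"
    "\<And>\<chi> x. \<chi> \<in> Irr \<Longrightarrow> \<chi> x = c \<chi> * unit_coeff (x * E \<chi>)"
  proof -
    have "\<forall>\<chi>\<in>Irr. \<exists>c. c \<noteq> 0 \<and> (\<forall>x. \<chi> x = c * unit_coeff (x * E \<chi>))"
      using E character_eq_unit_coeff by blast
    then obtain c where "\<forall>\<chi>\<in>Irr. c \<chi> \<noteq> 0 \<and> (\<forall>x. \<chi> x = c \<chi> * unit_coeff (x * E \<chi>))"
      by (rule bchoice[THEN exE])
    then show ?thesis using that by blast
  qed
  have inj: "inj_on E Irr"
    by (rule inj_onI) (metis idem(1,2) orth)
  \<comment> \<open>Finiteness comes first: a sum over an infinite set would be zero by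
    convention.\<close>
  have "independent (E ` Irr)"
    by (rule independent_orthogonal_idempotents) (auto simp: idem intro: orth)
  then have fin: "finite Irr" using finiteI_independent finite_imageD[OF _ inj] by blast
  have E_sum: "E \<chi> * (\<Sum>\<chi>'\<in>Irr. E \<chi>') = E \<chi>" if "\<chi> \<in> Irr" for \<chi>
  proof -
    have "E \<chi> * (\<Sum>\<chi>'\<in>Irr. E \<chi>') = (\<Sum>\<chi>'\<in>Irr. if \<chi>' = \<chi> then E \<chi> else 0)"
      unfolding sum_distrib_left using that by (intro sum.cong) (auto simp: idem orth)
    then show ?thesis using that fin by simp
  qed
  \<comment> \<open>The complementary central idempotent, orthogonal to every support.\<close>
  define g where "g = 1 - (\<Sum>\<chi>\<in>Irr. E \<chi>)"
  have Eg: "E \<chi> * g = 0" if "\<chi> \<in> Irr" for \<chi>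
    using E_sum[OF that] by (simp add: g_def right_diff_distrib)
  have "g * g = g - (\<Sum>\<chi>\<in>Irr. E \<chi> * g)"
    by (simp add: g_def left_diff_distrib sum_distrib_right)
  then have gg: "g * g = g" by (simp add: Eg)
  have gc: "g * x = x * g" for x
    by (simp add: g_def left_diff_distrib right_diff_distrib sum_distrib_left sum_distrib_right
        central cong: sum.cong)
  \<comment> \<open>Otherwise a minimal left ideal in the corner of \<open>g\<close> carries an
    irreducible representation \<open>\<rho>\<close>. The support of its character is orthogonal to
    \<open>g\<close>, so \<open>\<rho> g\<close> is zero and \<open>g\<close> annihilates
    \<open>L\<close>; but \<open>g * l = l * g = l\<close> is nonzero.\<close>
  have "g = 0"
  proof (rule ccontr)
    assume "g \<noteq> 0"
    then obtain L l where L: "minimal_left_ideal L" "l \<in> L" "l \<noteq> 0" "l * g = l"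
      using minimal_left_ideal_in_corner[OF gg] by blast
    obtain n \<rho> where \<rho>: "is_irreducible_representation n \<rho>"
      "\<And>x y. \<rho> x = 0\<^sub>m n n \<Longrightarrow> y \<in> L \<Longrightarrow> x * y = 0"
      using irreducible_representation_on_minimal_left_ideal[OF L(1)] by blast
    define \<chi> where "\<chi> = (\<lambda>x. mat_trace (\<rho> x))"
    obtain e where e: "character_support \<chi> e n \<rho>"
      using character_support_exists[OF \<rho>(1)] unfolding \<chi>_def by blast
    then have \<chi>: "\<chi> \<in> Irr" using Irr_iff_character_support by blast
    have "E \<chi> = e" using E[OF \<chi>] character_support_unique[OF _ e] by blast
    then have "e * g = 0" using Eg[OF \<chi>] by simp
    note D = character_supportD[OF e] and R = is_representationD[OF character_supportD(2)[OF e]]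
    have "\<rho> g = \<rho> e * \<rho> g" using left_mult_one_mat[OF R(1), of g] D(6) by simp
    also have "\<dots> = \<rho> (e * g)" by (simp add: R(4))
    also have "\<dots> = 0\<^sub>m n n" using \<open>e * g = 0\<close> is_representation_zero[OF D(2)] by simp
    finally have "g * l = 0" using \<rho>(2) L(2) by blast
    then show False using gc[of l] L(3,4) by simp
  qed
  then have sum1: "(\<Sum>\<chi>\<in>Irr. E \<chi>) = 1" by (simp add: g_def)
  have trace_eq: "standard_feasible_trace x = of_real total_degree * unit_coeff x" for x
  proof -
    have "standard_feasible_trace x
        = (\<Sum>b\<in>B. if b = 1 then representation B x 1 * of_real total_degree else 0)"
      unfolding standard_feasible_trace_def by (intro sum.cong) auto
    then show ?thesis using one_in_basis finite_Basis by (simp add: unit_coeff_def)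
  qed
  have total_pos: "total_degree > 0"
    unfolding total_degree_def using one_in_basis
    by (intro sum_pos) (auto simp: basis_degree_pos finite_Basis)
  \<comment> \<open>Evaluating at \<open>E \<chi>\<close> removes all other characters, since
    \<open>\<chi>'\<close> is a multiple of \<open>unit_coeff (x * E \<chi>')\<close> and distinct
    supports are orthogonal.\<close>
  have coeff: "m \<chi> = of_real total_degree / c \<chi>"
    if m: "\<forall>x. standard_feasible_trace x = (\<Sum>\<chi>\<in>Irr. m \<chi> * \<chi> x)" and \<chi>: "\<chi> \<in> Irr" for m \<chi>
  proof -
    have "standard_feasible_trace (E \<chi>) = (\<Sum>\<chi>'\<in>Irr. m \<chi>' * \<chi>' (E \<chi>))" using m by blast
    also have "\<dots> = (\<Sum>\<chi>'\<in>Irr. if \<chi>' = \<chi> then m \<chi> * (c \<chi> * unit_coeff (E \<chi>)) else 0)"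
    proof (intro sum.cong refl)
      fix \<chi>' assume \<chi>': "\<chi>' \<in> Irr"
      show "m \<chi>' * \<chi>' (E \<chi>) = (if \<chi>' = \<chi> then m \<chi> * (c \<chi> * unit_coeff (E \<chi>)) else 0)"
        unfolding c(2)[OF \<chi>', of "E \<chi>"] using \<chi> \<chi>' by (auto simp: idem orth unit_coeff_zero)
    qed
    also have "\<dots> = m \<chi> * (c \<chi> * unit_coeff (E \<chi>))" using \<chi> fin by simp
    finally show ?thesis
      using idem(3)[OF \<chi>] c(1)[OF \<chi>] by (simp add: trace_eq field_simps)
  qed
  show ?thesis
  proof (rule ex1I[of _ "\<lambda>\<chi>\<in>Irr. of_real total_degree / c \<chi>"], intro conjI allI)
    show "(\<lambda>\<chi>\<in>Irr. of_real total_degree / c \<chi>) \<in> Irr \<rightarrow>\<^sub>E - {0}"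
      using c(1) total_pos by auto
    fix x
    have "(\<Sum>\<chi>\<in>Irr. (\<lambda>\<chi>\<in>Irr. of_real total_degree / c \<chi>) \<chi> * \<chi> x)
        = (\<Sum>\<chi>\<in>Irr. of_real total_degree * unit_coeff (x * E \<chi>))"
    proof (intro sum.cong refl)
      fix \<chi> assume \<chi>: "\<chi> \<in> Irr"
      show "(\<lambda>\<chi>\<in>Irr. of_real total_degree / c \<chi>) \<chi> * \<chi> x
          = of_real total_degree * unit_coeff (x * E \<chi>)"
        unfolding c(2)[OF \<chi>, of x] using \<chi> c(1)[OF \<chi>] by simp
    qed
    also have "\<dots> = of_real total_degree * unit_coeff (\<Sum>\<chi>\<in>Irr. x * E \<chi>)"
      by (simp add: functional_sum[of unit_coeff] unit_coeff_linear sum_distrib_left)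
    also have "\<dots> = standard_feasible_trace x"
      by (simp add: sum_distrib_left[symmetric] sum1 trace_eq)
    finally show "standard_feasible_trace x
      = (\<Sum>\<chi>\<in>Irr. (\<lambda>\<chi>\<in>Irr. of_real total_degree / c \<chi>) \<chi> * \<chi> x)" by simp
  next
    fix m assume m: "m \<in> Irr \<rightarrow>\<^sub>E - {0} \<and>
      (\<forall>x. standard_feasible_trace x = (\<Sum>\<chi>\<in>Irr. m \<chi> * \<chi> x))"
    show "m = (\<lambda>\<chi>\<in>Irr. of_real total_degree / c \<chi>)"
    proof (rule ext)
      fix \<chi>
      show "m \<chi> = (\<lambda>\<chi>\<in>Irr. of_real total_degree / c \<chi>) \<chi>"
      proof (cases "\<chi> \<in> Irr")
        case True then show ?thesis using coeff[OF conjunct2[OF m]] by simp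
      next
        case False then show ?thesis using PiE_arb[OF conjunct1[OF m]] by simp
      qed
    qed
  qed
qed

end

subsection \<open>Transport along isomorphisms\<close>

text \<open>Both sides are linear in \<open>x\<close>, and on basis elements they agree because
  \<open>f a = f b\<close> only if \<open>a = b\<close>.\<close>

lemma representation_inj_image:
  assumes "based_algebra scale B" "based_algebra scale' B'"
    and add: "\<And>x y. f (x + y) = f x + f y" and scale: "\<And>c x. f (scale c x) = scale' c (f x)"
    and basis: "f ` B = B'" and inj: "inj f" and b: "b \<in> B"
  shows "module.representation scale' B' (f x) (f b) = module.representation scale B x b"
proof -
  interpret S: based_algebra scale B by fact
  interpret T: based_algebra scale' B' by fact
  show ?thesis
  proof (rule S.functional_eqI[where f = "\<lambda>x. T.representation B' (f x) (f b)"])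
    show "T.representation B' (f a) (f b) = S.representation B a b" if a: "a \<in> B" for a
    proof -
      have "f a \<in> B'" using a basis by blast
      then show ?thesis
        using inj by (simp add: T.representation_basis[OF T.independent_Basis]
            S.representation_basis[OF S.independent_Basis a] inj_eq)
    qed
  qed (simp_all add: add scale T.representation_add[OF T.independent_Basis] T.span_Basis
      T.representation_scale[OF T.independent_Basis] S.span_Basis
      S.representation_add[OF S.independent_Basis] S.representation_scale[OF S.independent_Basis])
qed

text \<open>As \<open>f\<close> is surjective, \<open>\<rho> \<circ> f\<close> and
  \<open>\<rho>\<close> have the same set of matrices and so the same invariant subspaces.\<close>

lemma Irr_comp:
  assumes "based_algebra scale B" "based_algebra scale' B'"
    and add: "\<And>x y. f (x + y) = f x + f y" and scale: "\<And>c x. f (scale c x) = scale' c (f x)"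
    and mult: "\<And>x y. f (x * y) = f x * f y" and one: "f 1 = 1" and surj: "surj f"
    and \<chi>: "\<chi> \<in> based_algebra.Irr scale'"
  shows "\<chi> \<circ> f \<in> based_algebra.Irr scale"
proof -
  interpret S: based_algebra scale B by fact
  interpret T: based_algebra scale' B' by fact
  obtain n \<rho> where \<rho>: "T.is_irreducible_representation n \<rho>" "\<And>x. \<chi> x = (\<Sum>i<n. \<rho> x $$ (i, i))"
    using \<chi> unfolding T.Irr_def by blast
  note D = T.is_representationD[OF T.is_irreducible_representationD(1)[OF \<rho>(1)]]
  have "S.is_representation n (\<rho> \<circ> f)"
    unfolding S.is_representation_def by (simp add: add scale mult one D)
  then have "S.is_irreducible_representation n (\<rho> \<circ> f)"
  proof (rule S.is_irreducible_representationI)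
    fix W assume W: "W \<subseteq> carrier_vec n" "0\<^sub>v n \<in> W" "\<And>v w. v \<in> W \<Longrightarrow> w \<in> W \<Longrightarrow> v + w \<in> W"
      "\<And>c v. v \<in> W \<Longrightarrow> c \<cdot>\<^sub>v v \<in> W" "\<And>x v. v \<in> W \<Longrightarrow> (\<rho> \<circ> f) x *\<^sub>v v \<in> W"
    have inv: "\<rho> y *\<^sub>v v \<in> W" if "v \<in> W" for y v
    proof -
      obtain x where "y = f x" using surj by blast
      then show ?thesis using W(5)[OF that, of x] by simp
    qed
    show "W = {0\<^sub>v n} \<or> W = carrier_vec n"
      by (rule T.is_irreducible_representationD(3)[OF \<rho>(1) W(1,2)]) (simp_all add: W(3,4) inv)
  qed (rule T.is_irreducible_representationD(2)[OF \<rho>(1)])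
  then show ?thesis unfolding S.Irr_def using \<rho>(2) by fastforce
qed

theorem lemma3p9:
  fixes scale :: "complex \<Rightarrow> 'a::ring_1 \<Rightarrow> 'a" and B :: "'a set" and star :: "'a \<Rightarrow> 'a"
    and scale' :: "complex \<Rightarrow> 'b::ring_1 \<Rightarrow> 'b" and B' :: "'b set" and star' :: "'b \<Rightarrow> 'b"
  assumes "C_algebra scale B star"
    and "C_algebra scale' B' star'"
    and "C_algebra_isomorphic scale B star scale' B' star'"
  shows "C_algebra.standard_feasible_multiplicities scale B star =
         C_algebra.standard_feasible_multiplicities scale' B' star'"
proof -
  interpret S: C_algebra scale B star by fact
  interpret T: C_algebra scale' B' star' by fact
  obtain f where "C_algebra_hom scale B star scale' B' star' f" and bij: "bij f"
    using assms(3) unfolding C_algebra_isomorphic_def by blast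
  then interpret H: C_algebra_hom scale B star scale' B' star' f by blast
  have inj: "inj f" and surj: "surj f" using bij bij_is_inj bij_is_surj by blast+
  have rep: "T.representation B' (f x) (f b) = S.representation B x b" if "b \<in> B" for x b
    by (rule representation_inj_image[OF S.based_algebra_axioms T.based_algebra_axioms
          H.hom_add H.hom_scale H.hom_basis inj that])
  \<comment> \<open>The degree of \<open>b\<close> is the coefficient of \<open>1\<close> in
    \<open>b * star b\<close>, and \<open>f\<close> preserves products, the involution and
    \<open>1\<close>.\<close>
  have deg: "T.basis_degree (f b) = S.basis_degree b" if "b \<in> B" for b
    using rep[OF S.one_in_basis, of "b * star b"]
    by (simp add: T.basis_degree_def S.basis_degree_def T.structure_constant_def
        S.structure_constant_def H.hom_mult H.hom_star H.hom_one)
  have B': "(\<Sum>b\<in>B'. h b) = (\<Sum>b\<in>B. h (f b))" for h :: "'b \<Rightarrow> 'c::comm_monoid_add"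
    unfolding H.hom_basis[symmetric] by (rule sum.reindex_cong[OF inj_on_subset[OF inj]]) auto
  have total: "T.total_degree = S.total_degree"
    by (simp add: T.total_degree_def S.total_degree_def B' deg)
  have f1: "f b = 1 \<longleftrightarrow> b = 1" for b using inj H.hom_one by (metis injD)
  have trace: "T.standard_feasible_trace (f x) = S.standard_feasible_trace x" for x
    by (simp add: T.standard_feasible_trace_def S.standard_feasible_trace_def B' rep total f1 cong: if_cong)
  define g where "g = inv_into UNIV f"
  have fg: "f (g y) = y" and gf: "g (f x) = x" for x y
    using inj surj by (simp_all add: g_def surj_f_inv_f)
  have g_hom: "g (x + y) = g x + g y" "g (scale' c x) = scale c (g x)" "g (x * y) = g x * g y"
    "g 1 = 1" for x y c
    by (metis fg gf H.hom_add, metis fg gf H.hom_scale, metis fg gf H.hom_mult, metis gf H.hom_one)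
  have surj_g: "surj g" using gf by (metis surjI)
  have to_S: "\<chi> \<circ> f \<in> S.Irr" if "\<chi> \<in> T.Irr" for \<chi>
    by (rule Irr_comp[OF S.based_algebra_axioms T.based_algebra_axioms
          H.hom_add H.hom_scale H.hom_mult H.hom_one surj that])
  have to_T: "\<chi> \<circ> g \<in> T.Irr" if "\<chi> \<in> S.Irr" for \<chi>
    by (rule Irr_comp[OF T.based_algebra_axioms S.based_algebra_axioms g_hom surj_g that])
  have comp: "\<chi> \<circ> g \<circ> f = \<chi>" "\<chi>' \<circ> f \<circ> g = \<chi>'"
    for \<chi> :: "'a \<Rightarrow> complex" and \<chi>' :: "'b \<Rightarrow> complex"
    by (auto simp: fg gf)
  \<comment> \<open>Characters are transported by composing with \<open>g\<close>; composing with
    \<open>f\<close> is the inverse.\<close>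
  have bij_Irr: "bij_betw (\<lambda>\<chi>. \<chi> \<circ> g) S.Irr T.Irr"
    by (rule bij_betw_byWitness[where f' = "\<lambda>\<chi>. \<chi> \<circ> f"]) (use to_S to_T comp in auto)
  let ?m = "T.standard_feasible_multiplicity"
  have m: "?m \<in> T.Irr \<rightarrow>\<^sub>E - {0}"
    "\<And>y. T.standard_feasible_trace y = (\<Sum>\<chi>\<in>T.Irr. ?m \<chi> * \<chi> y)"
    using theI'[OF T.standard_feasible_multiplicity_unique_exists]
    unfolding T.standard_feasible_multiplicity_def by blast+
  \<comment> \<open>The family pulled back from the target satisfies the defining property in the
    source, so uniqueness identifies it with the definite description. Restricting it to
    \<open>S.Irr\<close> supplies the required value \<open>undefined\<close> elsewhere.\<close>
  have "S.standard_feasible_multiplicity = (\<lambda>\<chi>\<in>S.Irr. ?m (\<chi> \<circ> g))"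
    unfolding S.standard_feasible_multiplicity_def
  proof (rule the1_equality[OF S.standard_feasible_multiplicity_unique_exists], intro conjI allI)
    show "(\<lambda>\<chi>\<in>S.Irr. ?m (\<chi> \<circ> g)) \<in> S.Irr \<rightarrow>\<^sub>E - {0}"
      using m(1) to_T by (auto simp: PiE_iff)
    fix x
    have "S.standard_feasible_trace x = (\<Sum>\<chi>\<in>T.Irr. ?m \<chi> * \<chi> (f x))"
      using trace[of x] m(2)[of "f x"] by simp
    also have "\<dots> = (\<Sum>\<chi>\<in>S.Irr. ?m (\<chi> \<circ> g) * (\<chi> \<circ> g) (f x))"
      by (rule sum.reindex_bij_betw[OF bij_Irr, symmetric])
    also have "\<dots> = (\<Sum>\<chi>\<in>S.Irr. (\<lambda>\<chi>\<in>S.Irr. ?m (\<chi> \<circ> g)) \<chi> * \<chi> x)"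
      by (intro sum.cong) (auto simp: gf)
    finally show "S.standard_feasible_trace x = (\<Sum>\<chi>\<in>S.Irr. (\<lambda>\<chi>\<in>S.Irr. ?m (\<chi> \<circ> g)) \<chi> * \<chi> x)" .
  qed
  then have "S.standard_feasible_multiplicities = (\<lambda>\<chi>. ?m (\<chi> \<circ> g)) ` S.Irr"
    unfolding S.standard_feasible_multiplicities_def by auto
  also have "\<dots> = ?m ` (\<lambda>\<chi>. \<chi> \<circ> g) ` S.Irr" by (simp only: image_image)
  also have "(\<lambda>\<chi>. \<chi> \<circ> g) ` S.Irr = T.Irr" using bij_Irr by (simp add: bij_betw_def)
  finally show ?thesis unfolding T.standard_feasible_multiplicities_def .
qed

end
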